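(* Let $V:\mathbb R\to\mathbb R$ be a $C^3$ admissible potential whose equilibrium measure has support $[-2c+b,2c+b]$, with $b\in\mathbb R$ and $c>0$. Then $$I_V=-\log c+\int_{-2}^2\frac{V(cx+b)\,dx}{\pi\sqrt{4-x^2}}-\int_0^cs\left[\left(\int_{-2}^2\frac{xV'(sx+b)\,dx}{2\pi\sqrt{4-x^2}}\right)^2+\left(\int_{-2}^2\frac{V'(sx+b)\,dx}{\pi\sqrt{4-x^2}}\right)^2\right]ds.$$
   Context: An admissible potential is a lower semicontinuous $V:\mathbb R\to\mathbb R$ with $\lim_{|x|\to\infty}\frac{V(x)}{2\log|x|}>1$ (possibly $+\infty$). For such $V$, $$I_V=\inf_{\mu\in\mathcal P(\mathbb R)}\Big\{\int V(x)\,\mu(dx)-\iint\log|x-y|\,\mu(dx)\mu(dy)\Big\},$$ where $\mathcal P(\mathbb R)$ is the set of Borel probability measures on $\mathbb R$. The infimum is attained by a unique, compactly supported measure, called the equilibrium measure of $V$. *)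

theory Defs
  imports "HOL-Probability.Probability"
begin

definition lower_semicontinuous :: "(real \<Rightarrow> real) \<Rightarrow> bool" where
  "lower_semicontinuous V \<longleftrightarrow> (\<forall>x. \<forall>a < V x. \<forall>\<^sub>F y in nhds x. a < V y)"

definition admissible_potential :: "(real \<Rightarrow> real) \<Rightarrow> bool" where
  "admissible_potential V \<longleftrightarrow> lower_semicontinuous V \<and>
     (\<exists>L::ereal. L > 1 \<and> ((\<lambda>x. ereal (V x / (2 * ln \<bar>x\<bar>))) \<longlongrightarrow> L) at_infinity)"

definition C_k :: "nat \<Rightarrow> (real \<Rightarrow> real) \<Rightarrow> bool" where
  "C_k k f \<longleftrightarrow> (\<forall>j<k. \<forall>x. (deriv ^^ j) f field_differentiable at x) \<and>
     continuous_on UNIV ((deriv ^^ k) f)"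

(* On the reals of the library ln 0 = 0, which would hide the singularity of the
   logarithmic kernel on the diagonal and make point masses have finite energy. *)
definition ext_ln :: "real \<Rightarrow> ereal" where
  "ext_ln t = (if t = 0 then -\<infinity> else ereal (ln t))"

(* e2ennreal truncates negative values to 0, so this is the integral of the positive part minus
   the integral of the negative part. *)
definition ext_integral :: "'a measure \<Rightarrow> ('a \<Rightarrow> ereal) \<Rightarrow> ereal" where
  "ext_integral M f =
     enn2ereal (\<integral>\<^sup>+ x. e2ennreal (f x) \<partial>M) - enn2ereal (\<integral>\<^sup>+ x. e2ennreal (- f x) \<partial>M)"

(* An admissible V is bounded below, so its integral never is -\<infinity>. If it is finite, then so is
   the integral of the positive part of the logarithm, by the growth of V. If it is \<infinity>, the
   energy is \<infinity> whatever the second term is, because \<infinity> - \<infinity> = \<infinity> in type ereal;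
   this is the value given by the kernel (V x + V y) / 2 - ln |x - y|, which is bounded below. *)
definition log_energy :: "(real \<Rightarrow> real) \<Rightarrow> real measure \<Rightarrow> ereal" where
  "log_energy V \<mu> = ext_integral \<mu> (\<lambda>x. ereal (V x)) -
     ext_integral (\<mu> \<Otimes>\<^sub>M \<mu>) (\<lambda>(x, y). ext_ln \<bar>x - y\<bar>)"

definition I_min :: "(real \<Rightarrow> real) \<Rightarrow> ereal" where
  "I_min V = (INF \<mu>\<in>{\<mu>. real_distribution \<mu>}. log_energy V \<mu>)"

definition equilibrium_measure :: "(real \<Rightarrow> real) \<Rightarrow> real measure \<Rightarrow> bool" where
  "equilibrium_measure V \<mu> \<longleftrightarrow> real_distribution \<mu> \<and> log_energy V \<mu> = I_min V"

definition measure_support :: "real measure \<Rightarrow> real set" where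
  "measure_support \<mu> = {x. \<forall>U. open U \<longrightarrow> x \<in> U \<longrightarrow> emeasure \<mu> U > 0}"

end

(*
Put x = c (2 cos t) + b and let A_n be the mean of V(x) cos(n t) over t in [0,pi].  Perturbing the
equilibrium measure towards a competitor and using lower semicontinuity of logarithmic potentials
gives V - 2 \<integral> log|x - y| d\<mu>(y) = const almost everywhere with respect to the arcsine law of the support.
Since the mean of log|2 cos t - 2 cos p| cos(n t) is -cos(n p)/n (and 0 for n = 0), testing that
identity against cos(n t) turns it into \<integral> cos(n p) d\<mu> = -n A_n / 2, whence
I_V = -log c + A_0 - (1/2) \<Sum> n A_n^2.

The last sum is the integral over s of the theorem for every smooth function V.  With A_n(s), G_n(s)
formed from V and V' on the interval of parameter s, one has n A_n = s (G_{n-1} - G_{n+1}) and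
A_n' = G_{n-1} + G_{n+1}, so the derivatives 2 s (G_{n-1}^2 - G_{n+1}^2) of n A_n^2 telescope
to 2 s (G_0^2 + G_1^2).
*)

theory Submission
  imports Defs
begin

section \<open>Energy identity for cosine coefficients as the interval shrinks to its centre\<close>

section \<open>Cosine coefficients on shrinking intervals\<close>

text \<open>The Euler-Lagrange equality is wanted almost everywhere for the arcsine law, not for
  \<open>\<mu>\<close>, because the cosine moments of the kernel are means over the angle, and no
  density of \<open>\<mu>\<close> is at hand to transfer null sets. Two one-sided bounds give it.
  The potential of the minimiser is at most its own mean C at every point of the support, which is
  the whole interval. The arcsine law is itself a competitor of finite energy, so its mean of that
  potential is at least C.

  The logarithm has no sign and energies may be infinite, so the variational argument runs in
  [0, infinity]: competitors are confined to the support interval, where \<open>V + m\<close> and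
  \<open>R - ln |x - y|\<close> are nonnegative, and real arithmetic resumes once finiteness is
  known.

  Two limits need a rate. A bound on V'' over the interval makes the coefficients of V' of order 1/n
  uniformly in s, which removes the far end of the telescoping sum. It makes those of V of order
  1/n^2, so the cosine series of V converges absolutely and can be integrated termwise against
  \<open>\<mu>\<close>.\<close>

definition cosine_coeff :: "(real \<Rightarrow> real) \<Rightarrow> nat \<Rightarrow> real" where
  "cosine_coeff f n = integral {0..pi} (\<lambda>t. f t * cos (real n * t)) / pi"

text \<open>The boundary terms of the integration by parts vanish because \<open>sin (n * t)\<close>
  is zero at both 0 and pi, whatever the values of \<open>f\<close> there.\<close>

lemma cosine_coeff_parts:
  assumes d: "\<And>t. t \<in> {0..pi} \<Longrightarrow> (f has_real_derivative f' t) (at t)"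
    and c: "continuous_on {0..pi} f'"
  shows "real n * cosine_coeff f n = - integral {0..pi} (\<lambda>t. f' t * sin (real n * t)) / pi"
proof -
  have cf: "continuous_on {0..pi} f"
    using d by (meson DERIV_isCont continuous_at_imp_continuous_on)
  have i1: "(\<lambda>t. f' t * sin (real n * t)) integrable_on {0..pi}"
    by (intro integrable_continuous_real continuous_intros c)
  have i2: "(\<lambda>t. real n * (f t * cos (real n * t))) integrable_on {0..pi}"
    by (intro integrable_continuous_real continuous_intros cf)
  have "((\<lambda>t. f' t * sin (real n * t) + real n * (f t * cos (real n * t))) has_integral
      (f pi * sin (real n * pi) - f 0 * sin (real n * 0))) {0..pi}"
  proof (rule fundamental_theorem_of_calculus)
    fix t :: real assume t: "t \<in> {0..pi}"
    have "((\<lambda>t. f t * sin (real n * t)) has_real_derivative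
        f' t * sin (real n * t) + real n * (f t * cos (real n * t))) (at t within {0..pi})"
      by (rule has_field_derivative_at_within)
         (use d[OF t] in \<open>auto intro!: derivative_eq_intros\<close>)
    then show "((\<lambda>t. f t * sin (real n * t)) has_vector_derivative
        f' t * sin (real n * t) + real n * (f t * cos (real n * t))) (at t within {0..pi})"
      by (simp add: has_real_derivative_iff_has_vector_derivative)
  qed auto
  then have "integral {0..pi} (\<lambda>t. f' t * sin (real n * t) + real n * (f t * cos (real n * t))) = 0"
    by (simp add: integral_unique)
  then have "integral {0..pi} (\<lambda>t. f' t * sin (real n * t)) +
      real n * integral {0..pi} (\<lambda>t. f t * cos (real n * t)) = 0"
    using Henstock_Kurzweil_Integration.integral_add[OF i1 i2] by simp
  then show ?thesis
    by (simp add: cosine_coeff_def field_simps)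
qed

lemma cosine_coeff_integrable:
  assumes "continuous_on {0..pi} f"
  shows "(\<lambda>t. f t * cos (real n * t)) integrable_on {0..pi}"
  by (intro integrable_continuous_real continuous_intros assms)

lemma cosine_coeff_abs_le:
  assumes "continuous_on {0..pi} f" and "\<And>t. t \<in> {0..pi} \<Longrightarrow> \<bar>f t\<bar> \<le> M"
  shows "\<bar>cosine_coeff f n\<bar> \<le> M"
proof -
  have "norm (integral {0..pi} (\<lambda>t. f t * cos (real n * t))) \<le> M * (pi - 0)"
  proof (rule integral_bound)
    fix t :: real assume t: "t \<in> {0..pi}"
    have "\<bar>f t\<bar> * \<bar>cos (real n * t)\<bar> \<le> M * 1"
      using assms(2)[OF t] by (intro mult_mono) auto
    then show "norm (f t * cos (real n * t)) \<le> M" by (simp add: abs_mult)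
  qed (auto intro!: continuous_intros assms)
  then show ?thesis
    by (simp add: cosine_coeff_def field_simps)
qed

text \<open>Integration by parts and the chain rule leave the factor 2 sin t sin((n+1)t), which is
  the difference of the cosines of frequencies n and n + 2.\<close>

lemma cosine_coeff_circle_diff:
  assumes d: "\<And>x. (f has_real_derivative f' x) (at x)"
    and c: "continuous_on UNIV f'"
  shows "real (Suc n) * cosine_coeff (\<lambda>t. f (s * (2 * cos t) + b)) (Suc n) =
    s * (cosine_coeff (\<lambda>t. f' (s * (2 * cos t) + b)) n -
         cosine_coeff (\<lambda>t. f' (s * (2 * cos t) + b)) (Suc (Suc n)))"
proof -
  let ?g = "\<lambda>t. f' (s * (2 * cos t) + b)"
  have cg: "continuous_on A (\<lambda>t. ?g t * h t)" if "continuous_on A h" for h A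
    by (intro continuous_intros that continuous_on_compose2[OF c]) auto
  have cg': "continuous_on A ?g" for A
    using cg[of A "\<lambda>_. 1"] by simp
  have "real (Suc n) * cosine_coeff (\<lambda>t. f (s * (2 * cos t) + b)) (Suc n) =
     - integral {0..pi} (\<lambda>t. ?g t * (s * (2 * (- sin t))) * sin (real (Suc n) * t)) / pi"
  proof (rule cosine_coeff_parts)
    fix t :: real
    show "((\<lambda>t. f (s * (2 * cos t) + b)) has_real_derivative
        f' (s * (2 * cos t) + b) * (s * (2 * (- sin t)))) (at t)"
      by (rule DERIV_chain2[of f, OF d]) (auto intro!: derivative_eq_intros)
  next
    show "continuous_on {0..pi} (\<lambda>t. ?g t * (s * (2 * (- sin t))))"
      by (intro cg continuous_intros)
  qed
  also have "(\<lambda>t. ?g t * (s * (2 * (- sin t))) * sin (real (Suc n) * t)) =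
      (\<lambda>t. (- s) * (?g t * cos (real n * t) - ?g t * cos (real (Suc (Suc n)) * t)))"
  proof
    fix t
    have "2 * sin t * sin (real (Suc n) * t) = cos (real n * t) - cos (real (Suc (Suc n)) * t)"
      using sin_times_sin[of t "real (Suc n) * t"] cos_minus[of "t - real (Suc n) * t"]
      by (simp add: algebra_simps)
    then have "(- s) * (?g t * (cos (real n * t) - cos (real (Suc (Suc n)) * t))) =
       (- s) * (?g t * (2 * sin t * sin (real (Suc n) * t)))"
      by simp
    then show "?g t * (s * (2 * (- sin t))) * sin (real (Suc n) * t) =
      (- s) * (?g t * cos (real n * t) - ?g t * cos (real (Suc (Suc n)) * t))"
      unfolding right_diff_distrib by (simp only: mult_ac mult_minus_left mult_minus_right)
  qed
  also have "integral {0..pi} \<dots> = - s * (integral {0..pi} (\<lambda>t. ?g t * cos (real n * t)) -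
      integral {0..pi} (\<lambda>t. ?g t * cos (real (Suc (Suc n)) * t)))"
    by (subst integral_mult_right, subst Henstock_Kurzweil_Integration.integral_diff)
       (use cosine_coeff_integrable[OF cg'] in blast)+
  finally show ?thesis
    by (simp add: cosine_coeff_def field_simps)
qed

text \<open>Differentiation under the integral sign brings out 2 cos t; times cos((n+1)t) it is the
  sum of the cosines of the same two frequencies. This sum and the difference in
  \<open>cosine_coeff_circle_diff\<close> multiply to a difference of squares.\<close>

lemma cosine_coeff_circle_deriv:
  assumes d: "\<And>x. (f has_real_derivative f' x) (at x)"
    and c: "continuous_on UNIV f'"
  shows "((\<lambda>s. cosine_coeff (\<lambda>t. f (s * (2 * cos t) + b)) (Suc n)) has_real_derivative
    cosine_coeff (\<lambda>t. f' (s * (2 * cos t) + b)) n +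
    cosine_coeff (\<lambda>t. f' (s * (2 * cos t) + b)) (Suc (Suc n))) (at s)"
proof -
  let ?g = "\<lambda>t. f' (s * (2 * cos t) + b)"
  let ?F = "\<lambda>s t. f (s * (2 * cos t) + b) * cos (real (Suc n) * t)"
  let ?F' = "\<lambda>s t. f' (s * (2 * cos t) + b) * (2 * cos t) * cos (real (Suc n) * t)"
  have cf: "continuous_on UNIV f"
    using d by (meson DERIV_isCont continuous_at_imp_continuous_on)
  have cg: "continuous_on A ?g" for A
    by (intro continuous_intros continuous_on_compose2[OF c]) auto
  have "((\<lambda>s. integral (cbox 0 pi) (?F s)) has_field_derivative integral (cbox 0 pi) (?F' s))
      (at s within UNIV)"
  proof (rule leibniz_rule_field_derivative)
    fix s t :: real
    have "((\<lambda>s. f (s * (2 * cos t) + b)) has_real_derivative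
        f' (s * (2 * cos t) + b) * (2 * cos t)) (at s)"
      by (rule DERIV_chain2[of f, OF d]) (auto intro!: derivative_eq_intros)
    then show "((\<lambda>s. ?F s t) has_field_derivative ?F' s t) (at s within UNIV)"
      by (auto intro!: derivative_eq_intros)
  next
    fix s :: real
    show "?F s integrable_on cbox 0 pi"
      unfolding cbox_interval
      by (intro integrable_continuous_real continuous_intros continuous_on_compose2[OF cf]) auto
  next
    show "continuous_on (UNIV \<times> cbox 0 pi) (\<lambda>(s, t). ?F' s t)"
      unfolding split_beta
      by (intro continuous_intros continuous_on_compose2[OF c]) auto
  qed auto
  moreover have "?F' s = (\<lambda>t. ?g t * cos (real n * t) + ?g t * cos (real (Suc (Suc n)) * t))"
  proof
    fix t
    have "2 * cos t * cos (real (Suc n) * t) = cos (real n * t) + cos (real (Suc (Suc n)) * t)"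
      using cos_times_cos[of t "real (Suc n) * t"] cos_minus[of "t - real (Suc n) * t"]
      by (simp add: algebra_simps)
    then show "?F' s t = ?g t * cos (real n * t) + ?g t * cos (real (Suc (Suc n)) * t)"
      by (metis (no_types, lifting) distrib_left mult.assoc)
  qed
  moreover have "integral {0..pi} (\<lambda>t. ?g t * cos (real n * t) + ?g t * cos (real (Suc (Suc n)) * t)) =
     integral {0..pi} (\<lambda>t. ?g t * cos (real n * t)) +
     integral {0..pi} (\<lambda>t. ?g t * cos (real (Suc (Suc n)) * t))"
    by (rule Henstock_Kurzweil_Integration.integral_add) (rule cosine_coeff_integrable[OF cg])+
  ultimately have "((\<lambda>s. integral {0..pi} (?F s)) has_field_derivative
     integral {0..pi} (\<lambda>t. ?g t * cos (real n * t)) +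
     integral {0..pi} (\<lambda>t. ?g t * cos (real (Suc (Suc n)) * t))) (at s)"
    by simp
  from DERIV_cdivide[OF this, of pi] show ?thesis
    by (simp add: cosine_coeff_def add_divide_distrib)
qed

lemma cosine_coeff_circle_continuous:
  assumes "continuous_on UNIV f"
  shows "continuous_on A (\<lambda>s. cosine_coeff (\<lambda>t. f (s * (2 * cos t) + b)) n)"
proof -
  have "continuous_on UNIV (\<lambda>s. integral (cbox 0 pi) (\<lambda>t. f (s * (2 * cos t) + b) * cos (real n * t)))"
  proof (rule integral_continuous_on_param)
    show "continuous_on (UNIV \<times> cbox 0 pi) (\<lambda>(s, t). f (s * (2 * cos t) + b) * cos (real n * t))"
      unfolding split_beta
      by (intro continuous_intros continuous_on_compose2[OF assms]) auto
  qed
  then have "continuous_on UNIV (\<lambda>s. cosine_coeff (\<lambda>t. f (s * (2 * cos t) + b)) n)"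
    unfolding cosine_coeff_def by (intro continuous_intros) auto
  then show ?thesis
    by (rule continuous_on_subset) auto
qed

text \<open>The squares telescope with step two, so two terms survive at each end; those of index N
  and N + 1 are the remainder that a decay estimate has to remove.\<close>

lemma cosine_coeff_energy_partial:
  fixes b :: real
  assumes d: "\<And>x. (f has_real_derivative f' x) (at x)"
    and c: "continuous_on UNIV f'" and "0 \<le> r"
  defines "A \<equiv> \<lambda>n s. cosine_coeff (\<lambda>t. f (s * (2 * cos t) + b)) n"
    and "G \<equiv> \<lambda>n s. cosine_coeff (\<lambda>t. f' (s * (2 * cos t) + b)) n"
  shows "((\<lambda>s. 2 * s * ((G 0 s)\<^sup>2 + (G 1 s)\<^sup>2 - (G (Suc N) s)\<^sup>2 - (G N s)\<^sup>2)) has_integral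
     (\<Sum>n<N. real (Suc n) * (A (Suc n) r)\<^sup>2)) {0..r}"
proof -
  let ?S = "\<lambda>s. \<Sum>n<N. real (Suc n) * (A (Suc n) s)\<^sup>2"
  \<comment> \<open>At s = 0 the interval collapses to b: the factor s kills the right side of the
    difference identity, so the lower limit contributes nothing to the fundamental theorem.\<close>
  have zero: "A (Suc n) 0 = 0" for n
    using cosine_coeff_circle_diff[OF d c, of n 0 b] by (simp add: A_def)
  have tel: "(\<Sum>n<N. (G n s)\<^sup>2 - (G (Suc (Suc n)) s)\<^sup>2) =
      (G 0 s)\<^sup>2 + (G 1 s)\<^sup>2 - (G (Suc N) s)\<^sup>2 - (G N s)\<^sup>2" for s
    by (induction N) auto
  have "((\<lambda>s. 2 * s * ((G 0 s)\<^sup>2 + (G 1 s)\<^sup>2 - (G (Suc N) s)\<^sup>2 - (G N s)\<^sup>2)) has_integral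
     (?S r - ?S 0)) {0..r}"
  proof (rule fundamental_theorem_of_calculus)
    fix s :: real
    have "((\<lambda>s. real (Suc n) * (A (Suc n) s)\<^sup>2) has_real_derivative
        2 * s * ((G n s)\<^sup>2 - (G (Suc (Suc n)) s)\<^sup>2)) (at s)" for n
    proof -
      have dA: "(A (Suc n) has_real_derivative G n s + G (Suc (Suc n)) s) (at s)"
        unfolding A_def G_def by (rule cosine_coeff_circle_deriv[OF d c])
      have "((\<lambda>s. real (Suc n) * (A (Suc n) s)\<^sup>2) has_real_derivative
         2 * (real (Suc n) * A (Suc n) s) * (G n s + G (Suc (Suc n)) s)) (at s)"
        using dA by (auto intro!: derivative_eq_intros)
      also have "real (Suc n) * A (Suc n) s = s * (G n s - G (Suc (Suc n)) s)"
        using cosine_coeff_circle_diff[OF d c, of n s b] by (simp add: A_def G_def)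
      finally show ?thesis
        by (simp add: power2_eq_square algebra_simps)
    qed
    then have "(?S has_real_derivative
        (\<Sum>n<N. 2 * s * ((G n s)\<^sup>2 - (G (Suc (Suc n)) s)\<^sup>2))) (at s)"
      by (intro DERIV_sum) auto
    then show "(?S has_vector_derivative
        2 * s * ((G 0 s)\<^sup>2 + (G 1 s)\<^sup>2 - (G (Suc N) s)\<^sup>2 - (G N s)\<^sup>2)) (at s within {0..r})"
      by (simp add: has_real_derivative_iff_has_vector_derivative has_vector_derivative_at_within
          tel flip: sum_distrib_left)
  qed (use \<open>0 \<le> r\<close> in auto)
  then show ?thesis by (simp add: zero)
qed

text \<open>Uniformity in s matters because the bound is used under an integral over s. It is the
  difference identity with B a bound of |f'| on the largest interval [b - 2r, b + 2r], whence M = 2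
  r B. The alternative n = 0 is there because M / 0 is 0.\<close>

lemma cosine_coeff_circle_decay:
  assumes d: "\<And>x. (f has_real_derivative f' x) (at x)"
    and c: "continuous_on UNIV f'" and "0 \<le> r"
  obtains M where "0 \<le> M"
    "\<And>n s. s \<in> {0..r} \<Longrightarrow> \<bar>cosine_coeff (\<lambda>t. f (s * (2 * cos t) + b)) n\<bar> \<le> M / real n \<or> n = 0"
proof -
  have "compact (f' ` {b - 2 * r..b + 2 * r})"
    by (intro compact_continuous_image continuous_on_subset[OF c]) auto
  then obtain B where B: "\<And>x. x \<in> {b - 2 * r..b + 2 * r} \<Longrightarrow> \<bar>f' x\<bar> \<le> B"
    by (metis compact_imp_bounded bounded_real imageI)
  have B0: "0 \<le> B" using B[of b] \<open>0 \<le> r\<close> by force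
  show ?thesis
  proof (rule that)
    show "0 \<le> r * (2 * B)" using \<open>0 \<le> r\<close> B0 by simp
    fix n s assume s: "s \<in> {0..r}"
    let ?g = "\<lambda>t. f' (s * (2 * cos t) + b)"
    have "\<bar>?g t\<bar> \<le> B" for t
    proof (rule B)
      have "\<bar>s * cos t\<bar> \<le> r * 1"
        unfolding abs_mult using s by (intro mult_mono) auto
      then show "s * (2 * cos t) + b \<in> {b - 2 * r..b + 2 * r}"
        by (auto simp: abs_le_iff)
    qed
    moreover have "continuous_on {0..pi} ?g"
      by (intro continuous_intros continuous_on_compose2[OF c]) auto
    ultimately have g: "\<bar>cosine_coeff ?g k\<bar> \<le> B" for k
      by (intro cosine_coeff_abs_le) auto
    have "\<bar>cosine_coeff (\<lambda>t. f (s * (2 * cos t) + b)) (Suc m)\<bar> \<le> r * (2 * B) / real (Suc m)" for m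
    proof -
      have "real (Suc m) * \<bar>cosine_coeff (\<lambda>t. f (s * (2 * cos t) + b)) (Suc m)\<bar> =
          s * \<bar>cosine_coeff ?g m - cosine_coeff ?g (Suc (Suc m))\<bar>"
        using arg_cong[OF cosine_coeff_circle_diff[OF d c, of m s b], of abs] s
        by (simp add: abs_mult)
      also have "\<dots> \<le> r * (2 * B)"
        using s g[of m] g[of "Suc (Suc m)"] by (intro mult_mono) auto
      finally show ?thesis by (simp add: field_simps)
    qed
    then show "\<bar>cosine_coeff (\<lambda>t. f (s * (2 * cos t) + b)) n\<bar> \<le> r * (2 * B) / real n \<or> n = 0"
      by (cases n) auto
  qed
qed

text \<open>The decay lemma is applied to f' rather than f: the boundary coefficients of index N and
  N + 1 are of order 1/N uniformly on [0, r], so the integral of their squares tends to 0.\<close>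

lemma cosine_coeff_energy_sums:
  fixes b :: real
  assumes d: "\<And>x. (f has_real_derivative f' x) (at x)"
    and d': "\<And>x. (f' has_real_derivative f'' x) (at x)"
    and c: "continuous_on UNIV f''" and "0 \<le> r"
  defines "A \<equiv> \<lambda>n s. cosine_coeff (\<lambda>t. f (s * (2 * cos t) + b)) n"
    and "G \<equiv> \<lambda>n s. cosine_coeff (\<lambda>t. f' (s * (2 * cos t) + b)) n"
  shows "(\<lambda>n. real (Suc n) * (A (Suc n) r)\<^sup>2) sums
     (2 * integral {0..r} (\<lambda>s. s * ((G 0 s)\<^sup>2 + (G 1 s)\<^sup>2)))"
proof -
  have c': "continuous_on UNIV f'"
    using d' by (meson DERIV_isCont continuous_at_imp_continuous_on)
  have cG: "continuous_on {0..r} (G n)" for n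
    unfolding G_def by (rule cosine_coeff_circle_continuous[OF c'])
  obtain M where M: "0 \<le> M" "\<And>n s. s \<in> {0..r} \<Longrightarrow> \<bar>G n s\<bar> \<le> M / real n \<or> n = 0"
    using cosine_coeff_circle_decay[OF d' c \<open>0 \<le> r\<close>, of b] unfolding G_def by metis
  let ?J = "integral {0..r} (\<lambda>s. 2 * s * ((G 0 s)\<^sup>2 + (G 1 s)\<^sup>2))"
  \<comment> \<open>Each of the two boundary squares is at most M^2 / N^2, weakened to M^2 / N; the
    weight contributes 2 r and the length of the interval another r.\<close>
  have bound: "\<bar>(\<Sum>n<N. real (Suc n) * (A (Suc n) r)\<^sup>2) - ?J\<bar> \<le> 4 * r * M\<^sup>2 * r / real N"
    if "N > 0" for N
  proof -
    let ?R = "\<lambda>s. 2 * s * ((G (Suc N) s)\<^sup>2 + (G N s)\<^sup>2)"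
    have "((\<lambda>s. 2 * s * ((G 0 s)\<^sup>2 + (G 1 s)\<^sup>2)) has_integral ?J) {0..r}"
      by (intro integrable_integral integrable_continuous_real continuous_intros cG)
    moreover have "((\<lambda>s. 2 * s * ((G 0 s)\<^sup>2 + (G 1 s)\<^sup>2 - (G (Suc N) s)\<^sup>2 - (G N s)\<^sup>2))
        has_integral (\<Sum>n<N. real (Suc n) * (A (Suc n) r)\<^sup>2)) {0..r}"
      unfolding A_def G_def by (rule cosine_coeff_energy_partial[OF d c' \<open>0 \<le> r\<close>])
    ultimately have "((\<lambda>s. 2 * s * ((G 0 s)\<^sup>2 + (G 1 s)\<^sup>2) -
        2 * s * ((G 0 s)\<^sup>2 + (G 1 s)\<^sup>2 - (G (Suc N) s)\<^sup>2 - (G N s)\<^sup>2))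
        has_integral (?J - (\<Sum>n<N. real (Suc n) * (A (Suc n) r)\<^sup>2))) {0..r}"
      by (rule has_integral_diff)
    then have "(?R has_integral (?J - (\<Sum>n<N. real (Suc n) * (A (Suc n) r)\<^sup>2))) {0..r}"
      by (simp add: algebra_simps)
    then have "integral {0..r} ?R = ?J - (\<Sum>n<N. real (Suc n) * (A (Suc n) r)\<^sup>2)"
      by (rule integral_unique)
    moreover have "norm (integral {0..r} ?R) \<le> (4 * r * M\<^sup>2 / real N) * (r - 0)"
    proof (rule integral_bound)
      fix s assume s: "s \<in> {0..r}"
      have "(G k s)\<^sup>2 \<le> M\<^sup>2 / real N" if "k \<ge> N" for k
      proof -
        have "\<bar>G k s\<bar> \<le> M / real k" using M(2)[OF s, of k] that \<open>N > 0\<close> by auto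
        then have "(G k s)\<^sup>2 \<le> (M / real k)\<^sup>2"
          using power_mono[of "\<bar>G k s\<bar>" "M / real k" 2] by simp
        also have "\<dots> = M\<^sup>2 / (real k * real k)" by (simp add: power2_eq_square)
        also have "\<dots> \<le> M\<^sup>2 / real N"
        proof (rule divide_left_mono)
          have "real N * 1 \<le> real k * real k"
            using that \<open>N > 0\<close> by (intro mult_mono) auto
          then show "real N \<le> real k * real k" by simp
        qed (use \<open>N > 0\<close> that in auto)
        finally show ?thesis .
      qed
      from this[of N] this[of "Suc N"]
      have "(G (Suc N) s)\<^sup>2 + (G N s)\<^sup>2 \<le> 2 * (M\<^sup>2 / real N)" by simp
      then have "2 * s * ((G (Suc N) s)\<^sup>2 + (G N s)\<^sup>2) \<le> 2 * r * (2 * (M\<^sup>2 / real N))"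
        using s \<open>0 \<le> r\<close> by (intro mult_mono) auto
      then show "norm (?R s) \<le> 4 * r * M\<^sup>2 / real N"
        using s by (simp add: abs_mult)
    qed (use \<open>0 \<le> r\<close> in \<open>auto intro!: continuous_intros cG\<close>)
    ultimately show ?thesis by (simp add: abs_minus_commute)
  qed
  have "(\<lambda>N. (\<Sum>n<N. real (Suc n) * (A (Suc n) r)\<^sup>2) - ?J) \<longlonglongrightarrow> 0"
  proof (rule Lim_null_comparison)
    show "\<forall>\<^sub>F N in sequentially. norm ((\<Sum>n<N. real (Suc n) * (A (Suc n) r)\<^sup>2) - ?J) \<le> 4 * r * M\<^sup>2 * r / real N"
      using bound by (auto intro!: eventually_sequentiallyI[of 1])
    show "(\<lambda>N. 4 * r * M\<^sup>2 * r / real N) \<longlonglongrightarrow> 0"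
      by (rule lim_const_over_n)
  qed
  then have "(\<lambda>n. real (Suc n) * (A (Suc n) r)\<^sup>2) sums ?J"
    unfolding sums_def by (simp add: LIM_zero_iff)
  then show ?thesis
    by (simp add: mult.assoc)
qed

section \<open>Orthogonality, uniqueness and uniform convergence of cosine series\<close>

section \<open>Cosine series\<close>

lemma integral_cos_multiple:
  "integral {0..pi} (\<lambda>t. cos (real_of_int j * t)) = (if j = 0 then pi else 0)"
proof (cases "j = 0")
  case False
  have "((\<lambda>t. cos (real_of_int j * t)) has_integral
      (sin (real_of_int j * pi) / real_of_int j - sin (real_of_int j * 0) / real_of_int j)) {0..pi}"
  proof (rule fundamental_theorem_of_calculus)
    fix t :: real
    have "((\<lambda>t. sin (real_of_int j * t) / real_of_int j) has_real_derivative cos (real_of_int j * t))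
        (at t within {0..pi})"
      using False by (auto intro!: derivative_eq_intros)
    then show "((\<lambda>t. sin (real_of_int j * t) / real_of_int j) has_vector_derivative
        cos (real_of_int j * t)) (at t within {0..pi})"
      by (simp add: has_real_derivative_iff_has_vector_derivative)
  qed auto
  moreover have "sin (real_of_int j * pi) = 0"
    by (simp add: sin_zero_iff_int2)
  ultimately show ?thesis
    using False by (simp add: integral_unique)
qed auto

lemma integral_cos_times_cos:
  "integral {0..pi} (\<lambda>t. cos (real m * t) * cos (real n * t)) =
     (if m \<noteq> n then 0 else if m = 0 then pi else pi / 2)"
proof -
  have "(\<lambda>t. cos (real m * t) * cos (real n * t)) =
      (\<lambda>t. (cos (real_of_int (int m - int n) * t) + cos (real_of_int (int m + int n) * t)) / 2)"
    by (simp add: cos_times_cos algebra_simps)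
  moreover have "integral {0..pi} (\<lambda>t. cos (real_of_int (int m - int n) * t) + cos (real_of_int (int m + int n) * t)) =
      integral {0..pi} (\<lambda>t. cos (real_of_int (int m - int n) * t)) +
      integral {0..pi} (\<lambda>t. cos (real_of_int (int m + int n) * t))"
    by (rule Henstock_Kurzweil_Integration.integral_add)
       (auto intro!: integrable_continuous_real continuous_intros)
  ultimately show ?thesis
    unfolding integral_divide integral_cos_multiple by auto
qed

text \<open>Orthogonality to all cos(n t) spreads to all polynomials in cos t, and these are
  uniformly dense by the Weierstrass theorem for f(arccos x) on [-1, 1]. Replacing one factor f by
  such a polynomial shows that the integral of f^2 is 0.\<close>

lemma cosine_moments_zero_imp_zero:
  assumes c: "continuous_on {0..pi} f"
    and zero: "\<And>n. integral {0..pi} (\<lambda>t. f t * cos (real n * t)) = 0"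
    and t: "t \<in> {0..pi}"
  shows "f t = 0"
proof -
  \<comment> \<open>The induction on the power k keeps n arbitrary because multiplication by cos t
    moves frequency n to n - 1 and n + 1; n = 0 moves to 1 only and is treated separately.\<close>
  have pow: "integral {0..pi} (\<lambda>t. f t * cos t ^ k * cos (real n * t)) = 0" for k n
  proof (induction k arbitrary: n)
    case 0
    then show ?case by (simp add: zero)
  next
    case (Suc k)
    have int: "(\<lambda>t. f t * cos t ^ k * cos (real m * t)) integrable_on {0..pi}" for m
      by (intro integrable_continuous_real continuous_intros c)
    show ?case
    proof (cases n)
      case 0
      have "(\<lambda>t. f t * cos t ^ Suc k * cos (real n * t)) = (\<lambda>t. f t * cos t ^ k * cos (real 1 * t))"
        using 0 by (auto simp: mult_ac)
      then show ?thesis using Suc.IH[of 1] by simp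
    next
      case (Suc m)
      have "2 * cos t * cos (real (Suc m) * t) = cos (real m * t) + cos (real (Suc (Suc m)) * t)" for t
        using cos_times_cos[of t "real (Suc m) * t"] cos_minus[of "t - real (Suc m) * t"]
        by (simp add: algebra_simps)
      then have *: "(\<lambda>t. f t * cos t ^ Suc k * cos (real n * t)) =
          (\<lambda>t. (f t * cos t ^ k * cos (real m * t) + f t * cos t ^ k * cos (real (Suc (Suc m)) * t)) / 2)"
        unfolding Suc power_Suc distrib_left[symmetric]
        by (metis (no_types, opaque_lifting) mult.assoc mult.left_commute nonzero_mult_div_cancel_left zero_neq_numeral)
      show ?thesis
        unfolding * integral_divide
        unfolding Henstock_Kurzweil_Integration.integral_add[OF int[of m] int[of "Suc (Suc m)"]] Suc.IH
        by simp
    qed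
  qed
  have small: "integral {0..pi} (\<lambda>t. f t * f t) \<le> e * integral {0..pi} (\<lambda>t. \<bar>f t\<bar>)" if "e > 0" for e
  proof -
    have "continuous_on {-1..1} (\<lambda>x. f (arccos x))"
      by (rule continuous_on_compose2[OF c continuous_on_arccos'])
         (auto simp: arccos_lbound arccos_ubound)
    then obtain g where g: "real_polynomial_function g"
        "\<And>x. x \<in> {-1..1} \<Longrightarrow> \<bar>f (arccos x) - g x\<bar> < e"
      using Stone_Weierstrass_real_polynomial_function[of "{-1..1}" "\<lambda>x. f (arccos x)" e] \<open>e > 0\<close>
      by auto
    then obtain a d where gd: "g = (\<lambda>x. \<Sum>i\<le>d. a i * x ^ i)"
      by (auto simp: real_polynomial_function_iff_sum)
    have close: "\<bar>f t - g (cos t)\<bar> < e" if "t \<in> {0..pi}" for t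
      using g(2)[of "cos t"] that by (simp add: arccos_cos)
    have intp: "(\<lambda>t. a i * (f t * cos t ^ i * cos (real 0 * t))) integrable_on {0..pi}" for i
      by (intro integrable_continuous_real continuous_intros c)
    have "(\<lambda>t. f t * g (cos t)) = (\<lambda>t. \<Sum>i\<le>d. a i * (f t * cos t ^ i * cos (real 0 * t)))"
      by (auto simp: gd sum_distrib_left mult_ac)
    then have "integral {0..pi} (\<lambda>t. f t * g (cos t)) =
        (\<Sum>i\<le>d. integral {0..pi} (\<lambda>t. a i * (f t * cos t ^ i * cos (real 0 * t))))"
      by (simp only:) (rule Henstock_Kurzweil_Integration.integral_sum[OF finite_atMost intp])
    also have "\<dots> = 0"
      by (simp only: integral_mult_right pow) simp
    finally have fg: "integral {0..pi} (\<lambda>t. f t * g (cos t)) = 0" .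
    have cg: "continuous_on {0..pi} (\<lambda>t. g (cos t))"
      unfolding gd by (intro continuous_intros)
    have "integral {0..pi} (\<lambda>t. f t * f t) = integral {0..pi} (\<lambda>t. f t * f t) - integral {0..pi} (\<lambda>t. f t * g (cos t))"
      by (simp add: fg)
    also have "\<dots> = integral {0..pi} (\<lambda>t. f t * f t - f t * g (cos t))"
      by (rule Henstock_Kurzweil_Integration.integral_diff[symmetric])
         (auto intro!: integrable_continuous_real continuous_intros c cg)
    also have "\<dots> \<le> integral {0..pi} (\<lambda>t. e * \<bar>f t\<bar>)"
    proof (rule integral_le)
      fix t assume "t \<in> {0..pi}"
      then have "\<bar>f t\<bar> * \<bar>f t - g (cos t)\<bar> \<le> \<bar>f t\<bar> * e"
        using close[of t] by (intro mult_left_mono) auto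
      then have "\<bar>f t * f t - f t * g (cos t)\<bar> \<le> e * \<bar>f t\<bar>"
        by (simp flip: right_diff_distrib add: abs_mult mult.commute)
      then show "f t * f t - f t * g (cos t) \<le> e * \<bar>f t\<bar>" by linarith
    qed (auto intro!: integrable_continuous_real continuous_intros c cg)
    also have "\<dots> = e * integral {0..pi} (\<lambda>t. \<bar>f t\<bar>)" by simp
    finally show ?thesis .
  qed
  have "integral {0..pi} (\<lambda>t. f t * f t) \<le> 0"
  proof (rule field_le_epsilon)
    fix e :: real assume e: "e > 0"
    let ?B = "integral {0..pi} (\<lambda>t. \<bar>f t\<bar>)"
    have B: "?B \<ge> 0" by (rule integral_nonneg) (auto intro!: integrable_continuous_real continuous_intros c)
    \<comment> \<open>Dividing by \<open>?B + 1\<close> instead of \<open>?B\<close> covers the case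
      that \<open>?B\<close> is 0.\<close>
    have "e / (?B + 1) * ?B \<le> e"
    proof -
      have "?B / (?B + 1) \<le> 1" using B by (simp add: divide_simps)
      then show ?thesis using e mult_left_mono[of "?B / (?B + 1)" 1 e] by simp
    qed
    then show "integral {0..pi} (\<lambda>t. f t * f t) \<le> 0 + e"
      using small[of "e / (?B + 1)"] B e by simp
  qed
  moreover have "integral {0..pi} (\<lambda>t. f t * f t) \<ge> 0"
    by (rule integral_nonneg) (auto intro!: integrable_continuous_real continuous_intros c)
  ultimately have "integral {0..pi} (\<lambda>t. f t * f t) = 0" by linarith
  then have "\<forall>t\<in>{0..pi}. f t * f t = 0"
    by (subst (asm) integral_eq_0_iff) (auto intro!: continuous_intros c)
  then show ?thesis using t by simp
qed

text \<open>\<open>cosine_coeff\<close> is a plain mean over [0, pi], half the classical coefficient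
  at positive frequencies, hence the factor 2. The series converges uniformly to a continuous
  function with the same cosine moments as f, so uniqueness identifies the two.\<close>

lemma cosine_series_uniform_limit:
  assumes c: "continuous_on {0..pi} f"
    and s: "summable (\<lambda>n. \<bar>cosine_coeff f (Suc n)\<bar>)"
  shows "uniform_limit {0..pi}
    (\<lambda>N t. cosine_coeff f 0 + 2 * (\<Sum>n<N. cosine_coeff f (Suc n) * cos (real (Suc n) * t))) f sequentially"
proof -
  let ?a = "cosine_coeff f"
  let ?P = "\<lambda>N t. \<Sum>n<N. ?a (Suc n) * cos (real (Suc n) * t)"
  define q where "q = (\<lambda>t. \<Sum>n. ?a (Suc n) * cos (real (Suc n) * t))"
  let ?h = "\<lambda>t. ?a 0 + 2 * q t"
  have ul: "uniform_limit UNIV ?P q sequentially"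
    unfolding q_def
    by (rule Weierstrass_m_test[OF _ s]) (auto simp: abs_mult intro: mult_left_le)
  have ulh: "uniform_limit {0..pi} (\<lambda>N t. ?a 0 + 2 * ?P N t) ?h sequentially"
    using uniform_limit_on_subset[OF ul, of "{0..pi}"] by (auto intro!: uniform_limit_intros bounded_linear_mult_right)
  have ch: "continuous_on {0..pi} ?h"
    by (rule uniform_limit_theorem[OF _ ulh]) (auto intro!: continuous_intros always_eventually)
  have "f t - ?h t = 0" if "t \<in> {0..pi}" for t
  proof (rule cosine_moments_zero_imp_zero[of "\<lambda>t. f t - ?h t", OF _ _ that])
    show "continuous_on {0..pi} (\<lambda>t. f t - ?h t)" by (intro continuous_intros c ch)
    fix k
    have uk: "uniform_limit {0..pi} (\<lambda>N t. (f t - (?a 0 + 2 * ?P N t)) * cos (real k * t))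
        (\<lambda>t. (f t - ?h t) * cos (real k * t)) sequentially"
    proof (rule uniform_lim_mult)
      show "uniform_limit {0..pi} (\<lambda>N t. f t - (?a 0 + 2 * ?P N t)) (\<lambda>t. f t - ?h t) sequentially"
        by (intro uniform_limit_intros ulh)
      show "bounded ((\<lambda>t. f t - ?h t) ` {0..pi})"
        by (intro compact_imp_bounded compact_continuous_image continuous_intros c ch) auto
      show "bounded ((\<lambda>t. cos (real k * t)) ` {0..pi})"
        by (intro compact_imp_bounded compact_continuous_image continuous_intros) auto
    qed (rule uniform_limit_const)
    obtain I J where IJ: "\<And>N. ((\<lambda>t. (f t - (?a 0 + 2 * ?P N t)) * cos (real k * t)) has_integral I N) {0..pi}"
        "((\<lambda>t. (f t - ?h t) * cos (real k * t)) has_integral J) {0..pi}" "I \<longlonglongrightarrow> J"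
      by (rule uniform_limit_integral[OF uk]) (auto intro!: continuous_intros c)
    \<comment> \<open>The partial sum contains the frequencies 1, ..., N, so the moment of frequency
      k is matched exactly as soon as k <= N; the factor 2 times the integral pi / 2 of the squared
      cosine restores the pi divided out in the coefficient.\<close>
    have "I N = 0" if N: "k \<le> N" for N
    proof -
      have i1: "(\<lambda>t. f t * cos (real k * t)) integrable_on {0..pi}"
        and i2: "(\<lambda>t. ?a 0 * (cos (real 0 * t) * cos (real k * t))) integrable_on {0..pi}"
        and i3: "\<And>n. (\<lambda>t. ?a (Suc n) * (cos (real (Suc n) * t) * cos (real k * t))) integrable_on {0..pi}"
        by (auto intro!: integrable_continuous_real continuous_intros c)
      have i4: "(\<lambda>t. 2 * (\<Sum>n<N. ?a (Suc n) * (cos (real (Suc n) * t) * cos (real k * t)))) integrable_on {0..pi}"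
        by (auto intro!: integrable_continuous_real continuous_intros)
      have "(\<lambda>t. (f t - (?a 0 + 2 * ?P N t)) * cos (real k * t)) =
        (\<lambda>t. f t * cos (real k * t) - ?a 0 * (cos (real 0 * t) * cos (real k * t)) -
           2 * (\<Sum>n<N. ?a (Suc n) * (cos (real (Suc n) * t) * cos (real k * t))))"
        by (simp add: algebra_simps sum_distrib_left sum_distrib_right)
      then have "I N = integral {0..pi} \<dots>"
        using IJ(1)[of N] by (simp add: integral_unique)
      also have "\<dots> = integral {0..pi} (\<lambda>t. f t * cos (real k * t)) -
         ?a 0 * integral {0..pi} (\<lambda>t. cos (real 0 * t) * cos (real k * t)) -
         2 * (\<Sum>n<N. ?a (Suc n) * integral {0..pi} (\<lambda>t. cos (real (Suc n) * t) * cos (real k * t)))"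
        unfolding Henstock_Kurzweil_Integration.integral_diff[OF integrable_diff[OF i1 i2] i4]
          Henstock_Kurzweil_Integration.integral_diff[OF i1 i2] integral_mult_right
          Henstock_Kurzweil_Integration.integral_sum[OF finite_lessThan i3] by (rule refl)
      also have "\<dots> = 0"
      proof (cases k)
        case 0
        have "(\<Sum>n<N. ?a (Suc n) * integral {0..pi} (\<lambda>t. cos (real (Suc n) * t) * cos (real k * t))) = 0"
          unfolding integral_cos_times_cos using 0 by simp
        then show ?thesis
          unfolding integral_cos_times_cos using 0 by (simp add: cosine_coeff_def)
      next
        case (Suc j)
        have "(\<Sum>n<N. ?a (Suc n) * integral {0..pi} (\<lambda>t. cos (real (Suc n) * t) * cos (real k * t))) =
            (\<Sum>n<N. if n = j then ?a k * (pi / 2) else 0)"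
          unfolding integral_cos_times_cos using Suc by (intro sum.cong) auto
        also have "\<dots> = ?a k * (pi / 2)" using N Suc by simp
        finally show ?thesis
          unfolding integral_cos_times_cos using Suc by (simp add: cosine_coeff_def)
      qed
      finally show ?thesis .
    qed
    then have "I \<longlonglongrightarrow> 0"
      by (intro tendsto_eventually eventually_sequentiallyI[of k])
    then have "J = 0" using IJ(3) LIMSEQ_unique by blast
    then show "integral {0..pi} (\<lambda>t. (f t - ?h t) * cos (real k * t)) = 0"
      using IJ(2) by (simp add: integral_unique)
  qed
  then show ?thesis
    using ulh by (subst uniform_limit_cong'[where g = "\<lambda>N t. ?a 0 + 2 * ?P N t" and i = ?h]) auto
qed

text \<open>Two gains of 1/n: the difference identity divides coefficients of f' by n + 1, and these
  are themselves of order 1/n by the decay lemma.\<close>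

lemma cosine_coeff_circle_summable:
  assumes d: "\<And>x. (f has_real_derivative f' x) (at x)"
    and d': "\<And>x. (f' has_real_derivative f'' x) (at x)"
    and c: "continuous_on UNIV f''" and "0 \<le> r"
  shows "summable (\<lambda>n. \<bar>cosine_coeff (\<lambda>t. f (r * (2 * cos t) + b)) (Suc n)\<bar>)"
proof -
  have c': "continuous_on UNIV f'"
    using d' by (meson DERIV_isCont continuous_at_imp_continuous_on)
  let ?G = "cosine_coeff (\<lambda>t. f' (r * (2 * cos t) + b))"
  let ?A = "cosine_coeff (\<lambda>t. f (r * (2 * cos t) + b))"
  obtain M where M: "0 \<le> M" "\<And>n. \<bar>?G n\<bar> \<le> M / real n \<or> n = 0"
    using cosine_coeff_circle_decay[OF d' c \<open>0 \<le> r\<close>, of b] \<open>0 \<le> r\<close>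
    by (metis atLeastAtMost_iff order_refl)
  have "\<bar>?A (Suc n)\<bar> \<le> 2 * r * M * (1 / real n ^ 2)" if n: "n \<ge> 1" for n
  proof -
    have "\<bar>?G n\<bar> \<le> M / real n" using M(2)[of n] n by auto
    moreover have "\<bar>?G (Suc (Suc n))\<bar> \<le> M / real (Suc (Suc n))" using M(2)[of "Suc (Suc n)"] by auto
    moreover have "M / real (Suc (Suc n)) \<le> M / real n" using M(1) n by (intro divide_left_mono) auto
    ultimately have G: "\<bar>?G n - ?G (Suc (Suc n))\<bar> \<le> 2 * M / real n" by simp
    have "real n * \<bar>?A (Suc n)\<bar> \<le> real (Suc n) * \<bar>?A (Suc n)\<bar>" by (intro mult_right_mono) auto
    also have "\<dots> = r * \<bar>?G n - ?G (Suc (Suc n))\<bar>"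
      using arg_cong[OF cosine_coeff_circle_diff[OF d c', of n r b], of abs] \<open>0 \<le> r\<close>
      by (simp add: abs_mult)
    also have "\<dots> \<le> r * (2 * M / real n)" using G \<open>0 \<le> r\<close> by (intro mult_left_mono) auto
    finally show ?thesis using n by (simp add: field_simps power2_eq_square)
  qed
  moreover have sm: "summable (\<lambda>n. 2 * r * M * (1 / real n ^ 2))"
    by (intro summable_mult) (use inverse_power_summable[of 2, where ?'a = real] in \<open>simp only: inverse_eq_divide order_refl\<close>)
  ultimately show ?thesis
    by (intro summable_comparison_test'[OF sm, where N = 1]) simp
qed

section \<open>Cosine moments of log |2 cos t - 2 cos p| by Abel regularisation\<close>

section \<open>The logarithmic kernel in angular coordinates\<close>

text \<open>The uniform law on [0, pi], whose image under t -> 2 c cos t + b is the arcsine law. As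
  a probability measure on the whole line it can be paired with \<open>\<mu>\<close> in a
  product.\<close>

definition angle_measure :: "real measure" where
  "angle_measure = density lborel (\<lambda>t. ennreal (indicator {0..pi} t / pi))"

lemma sets_angle_measure [simp, measurable_cong]: "sets angle_measure = sets borel"
  by (simp add: angle_measure_def)

lemma space_angle_measure [simp]: "space angle_measure = UNIV"
  by (simp add: angle_measure_def)

lemma prob_space_angle_measure: "prob_space angle_measure"
proof
  have "emeasure angle_measure (space angle_measure) = (\<integral>\<^sup>+t. ennreal (1 / pi) * indicator {0..pi} t \<partial>lborel)"
    unfolding angle_measure_def
    by (simp add: emeasure_density) (auto intro!: nn_integral_cong simp: indicator_def)
  also have "\<dots> = 1"
    by (subst nn_integral_cmult_indicator) (auto simp: ennreal_mult[symmetric] simp flip: ennreal_1)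
  finally show "emeasure angle_measure (space angle_measure) = 1" .
qed

lemma AE_angle_measure_iff:
  assumes [measurable]: "Measurable.pred borel P"
  shows "(AE t in angle_measure. P t) \<longleftrightarrow> (AE t in lborel. t \<in> {0..pi} \<longrightarrow> P t)"
  unfolding angle_measure_def
  by (subst AE_density) (auto intro!: AE_cong simp: indicator_def)

text \<open>Cosine is injective on [0, pi], so the singularity of the logarithm is met at most
  once.\<close>

lemma AE_angle_measure_cos_neq: "AE t in angle_measure. cos t \<noteq> y"
proof (subst AE_angle_measure_iff)
  have "AE t in lborel. t \<noteq> arccos y" by (rule AE_lborel_singleton)
  then show "AE t in lborel. t \<in> {0..pi} \<longrightarrow> cos t \<noteq> y"
    by eventually_elim (auto simp: arccos_cos)
qed measurable

lemma integral_angle_measure: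
  assumes c: "continuous_on {0..pi} f" and [measurable]: "f \<in> borel_measurable borel"
  shows "integrable angle_measure f" "integral\<^sup>L angle_measure f = integral {0..pi} f / pi"
proof -
  have si: "set_integrable lborel {0..pi} f"
    by (rule borel_integrable_atLeastAtMost') (rule c)
  have eq: "(\<lambda>t. (indicator {0..pi} t / pi) *\<^sub>R f t) = (\<lambda>t. (indicator {0..pi} t *\<^sub>R f t) / pi)"
    by auto
  show "integrable angle_measure f"
    unfolding angle_measure_def
    by (subst integrable_density) (use si in \<open>auto simp: eq set_integrable_def\<close>)
  have "integral\<^sup>L angle_measure f = (LINT t|lborel. (indicator {0..pi} t *\<^sub>R f t) / pi)"
    unfolding angle_measure_def by (subst integral_density) (auto simp: eq)
  also have "\<dots> = integral {0..pi} f / pi"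
    using set_borel_integral_eq_integral(2)[OF si] by (simp add: set_lebesgue_integral_def)
  finally show "integral\<^sup>L angle_measure f = integral {0..pi} f / pi" .
qed

lemma cosine_coeff_eq_expectation:
  assumes "continuous_on {0..pi} f" and [measurable]: "f \<in> borel_measurable borel"
  shows "cosine_coeff f n = (\<integral>t. f t * cos (real n * t) \<partial>angle_measure)"
  unfolding cosine_coeff_def
  by (subst integral_angle_measure(2)) (auto intro!: continuous_intros assms)

text \<open>Real part of the power series of log(1 - r e^(iu)), with log |1 - r e^(iu)| written as
  half the logarithm of the squared modulus. The term k = 0 vanishes because division by 0 gives
  0.\<close>

lemma cos_series_sums_ln:
  assumes "0 \<le> r" "r < 1"
  shows "(\<lambda>k. - (r ^ k / real k) * cos (real k * u)) sums (ln (1 - 2 * r * cos u + r\<^sup>2) / 2)"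
proof -
  let ?z = "complex_of_real r * cis u"
  have n: "norm (- ?z) < 1" using assms by (simp add: norm_mult)
  then have nz: "1 + - ?z \<noteq> 0" by (metis add.right_neutral add_diff_cancel_left' diff_minus_eq_add
        add_eq_0_iff norm_one less_irrefl norm_minus_cancel)
  have "(\<lambda>k. Re (- ((- (- ?z)) ^ k) / of_nat k)) sums Re (ln (1 + - ?z))"
    by (rule sums_Re[OF Ln_series'[OF n]])
  moreover have "Re (- ((- (- ?z)) ^ k) / of_nat k) = - (r ^ k / real k) * cos (real k * u)" for k
  proof -
    have "Re (cis u ^ k) = cos (real k * u)"
      by (rule cos_n_Re_cis_pow_n[symmetric])
    then show ?thesis
      by (simp add: power_mult_distrib Re_divide_of_nat flip: of_real_power)
  qed
  moreover have "Re (ln (1 + - ?z)) = ln (1 - 2 * r * cos u + r\<^sup>2) / 2"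
  proof -
    have "(cmod (1 + - ?z))\<^sup>2 = 1 - 2 * r * cos u + r\<^sup>2"
      unfolding cmod_power2
      by (simp add: power2_eq_square algebra_simps) (use sin_cos_squared_add[of u] in algebra)
    moreover have "ln ((cmod (1 + - ?z))\<^sup>2) = 2 * ln (cmod (1 + - ?z))"
      using nz by (subst ln_realpow) auto
    ultimately show ?thesis using nz by (simp add: Re_Ln)
  qed
  ultimately show ?thesis by (simp only:)
qed

text \<open>This is log |1 - r e^(i(t + p))| + log |1 - r e^(i(t - p))|: smooth in t for 0 <= r < 1,
  and tending to log |2 cos t - 2 cos p| as r -> 1 away from the singularity.\<close>

definition poisson_log :: "real \<Rightarrow> real \<Rightarrow> real \<Rightarrow> real" where
  "poisson_log p r t = ln (1 - 2 * r * cos (t + p) + r\<^sup>2) / 2 + ln (1 - 2 * r * cos (t - p) + r\<^sup>2) / 2"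

lemma poisson_factor_pos:
  assumes "0 \<le> r" "r < (1::real)"
  shows "0 < 1 - 2 * r * cos u + r\<^sup>2"
proof -
  have "r * cos u \<le> r * 1" using assms by (intro mult_left_mono) auto
  moreover have "0 < (1 - r)\<^sup>2" using assms by simp
  ultimately show ?thesis by (simp add: power2_eq_square algebra_simps)
qed

lemma poisson_log_continuous:
  assumes "0 \<le> r" "r < 1"
  shows "continuous_on A (poisson_log p r)"
  unfolding poisson_log_def
  by (intro continuous_intros) (use poisson_factor_pos[OF assms] in \<open>auto simp: less_imp_neq dest: less_imp_neq[symmetric]\<close>)

text \<open>The two logarithmic series add up to a cosine series with coefficients -2 r^k cos(k p) /
  k. The geometric bound 2 r^k allows termwise integration, and orthogonality leaves only k =
  n.\<close>

lemma cosine_coeff_poisson_log: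
  assumes r: "0 \<le> r" "r < 1"
  shows "cosine_coeff (poisson_log p r) n = (if n = 0 then 0 else - (r ^ n * cos (real n * p) / real n))"
proof -
  let ?b = "\<lambda>k. - 2 * (r ^ k / real k) * cos (real k * p)"
  let ?P = "\<lambda>N t. \<Sum>k<N. ?b k * (cos (real k * t) * cos (real n * t))"
  have sums: "(\<lambda>k. ?b k * (cos (real k * t) * cos (real n * t))) sums (poisson_log p r t * cos (real n * t))" for t
  proof -
    have "- (r ^ k / real k) * cos (real k * (t + p)) + - (r ^ k / real k) * cos (real k * (t - p)) =
       ?b k * cos (real k * t)" for k
      by (simp add: distrib_left right_diff_distrib cos_add cos_diff algebra_simps)
    then have "(\<lambda>k. ?b k * cos (real k * t)) sums poisson_log p r t"
      using sums_add[OF cos_series_sums_ln[OF r, of "t + p"] cos_series_sums_ln[OF r, of "t - p"]]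
      by (simp add: poisson_log_def)
    from sums_mult2[OF this, of "cos (real n * t)"] show ?thesis by (simp only: mult.assoc)
  qed
  have ul: "uniform_limit {0..pi} ?P (\<lambda>t. \<Sum>k. ?b k * (cos (real k * t) * cos (real n * t))) sequentially"
  proof (rule Weierstrass_m_test)
    show "summable (\<lambda>k. 2 * r ^ k)" using r by (intro summable_mult summable_geometric) auto
    fix k t
    have "\<bar>r ^ k / real k\<bar> \<le> r ^ k"
      using r by (cases "k = 0") (auto simp: divide_simps mult_le_cancel_left1)
    then have "2 * \<bar>r ^ k / real k\<bar> * (\<bar>cos (real k * p)\<bar> * (\<bar>cos (real k * t)\<bar> * \<bar>cos (real n * t)\<bar>)) \<le> 2 * r ^ k * (1 * (1 * 1))"
      using r by (intro mult_mono) auto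
    then show "norm (?b k * (cos (real k * t) * cos (real n * t))) \<le> 2 * r ^ k"
      by (simp add: abs_mult mult.assoc)
  qed
  then have ul: "uniform_limit {0..pi} ?P (\<lambda>t. poisson_log p r t * cos (real n * t)) sequentially"
    using sums by (simp only: sums_iff)
  have cP: "continuous_on {0..pi} (?P N)" for N
    by (intro continuous_intros)
  obtain I J where IJ: "\<And>N. (?P N has_integral I N) {0..pi}"
      "((\<lambda>t. poisson_log p r t * cos (real n * t)) has_integral J) {0..pi}" "I \<longlonglongrightarrow> J"
    by (rule uniform_limit_integral[OF ul cP trivial_limit_sequentially]) blast
  let ?R = "if n = 0 then 0 else - (pi * r ^ n * cos (real n * p) / real n)"
  have "I N = ?R" if N: "n < N" for N
  proof -
    have i: "(\<lambda>t. ?b k * (cos (real k * t) * cos (real n * t))) integrable_on {0..pi}" for k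
      by (intro integrable_continuous_real continuous_intros)
    have "I N = integral {0..pi} (?P N)" using IJ(1)[of N] by (simp add: integral_unique)
    also have "\<dots> = (\<Sum>k<N. ?b k * integral {0..pi} (\<lambda>t. cos (real k * t) * cos (real n * t)))"
      unfolding Henstock_Kurzweil_Integration.integral_sum[OF finite_lessThan i] integral_mult_right by (rule refl)
    also have "\<dots> = (\<Sum>k<N. if k = n then ?R else 0)"
      unfolding integral_cos_times_cos by (intro sum.cong) auto
    also have "\<dots> = ?R" using N by simp
    finally show ?thesis .
  qed
  then have "I \<longlonglongrightarrow> ?R" by (intro tendsto_eventually eventually_sequentiallyI[of "Suc n"]) auto
  then have "J = ?R" using IJ(3) LIMSEQ_unique by blast
  then show ?thesis
    using IJ(2) by (auto simp: cosine_coeff_def integral_unique)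
qed

text \<open>At r = 1 the factors inside \<open>poisson_log\<close> are 2 (1 - cos(t + p)) and 2 (1 -
  cos(t - p)); this identity makes their product the square of 2 cos t - 2 cos p.\<close>

lemma cos_sum_diff_product: "(1 - cos (t + p)) * (1 - cos (t - p)) = (cos t - cos p)\<^sup>2" for t p :: real
  using sin_cos_squared_add[of t] sin_cos_squared_add[of p]
  unfolding cos_add cos_diff by algebra

text \<open>Each modulus |1 - r e^(iu)| is at most 2. Being free of r, the bound makes
  \<open>ln 4 - poisson_log p r t\<close> nonnegative, as Fatou's lemma requires.\<close>

lemma poisson_log_upper:
  assumes r: "0 \<le> r" "r < 1"
  shows "poisson_log p r t \<le> ln 4"
proof -
  have "ln (1 - 2 * r * cos u + r\<^sup>2) \<le> ln 4" for u
  proof (rule ln_mono)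
    have "r * (- 1) \<le> r * cos u" using r by (intro mult_left_mono) auto
    moreover have "r\<^sup>2 \<le> 1" using r by (simp add: power_le_one)
    ultimately show "1 - 2 * r * cos u + r\<^sup>2 \<le> 4" using r by (simp only: mult.assoc)
  qed (rule poisson_factor_pos[OF r])
  from this[of "t + p"] this[of "t - p"] show ?thesis by (simp add: poisson_log_def)
qed

text \<open>From 1 - 2 r cos u + r^2 = (1 - r)^2 + 2 r (1 - cos u) and r >= 1/4, each factor is at
  least a quarter of its value 2 (1 - cos u) at r = 1. Two factors lose 1/16, half of whose
  logarithm is - ln 4.\<close>

lemma poisson_log_lower:
  assumes r: "1/4 \<le> r" "r < 1" and ne: "cos t \<noteq> cos p"
  shows "ln \<bar>2 * cos t - 2 * cos p\<bar> - ln 4 \<le> poisson_log p r t"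
proof -
  have f: "(1 - cos u) / 2 \<le> 1 - 2 * r * cos u + r\<^sup>2" for u
  proof -
    have "(1 / 4) * (1 - cos u) \<le> r * (1 - cos u)" using r by (intro mult_right_mono) auto
    moreover have "0 \<le> (1 - r)\<^sup>2" by simp
    ultimately show ?thesis by (simp add: power2_eq_square algebra_simps)
  qed
  have p: "0 < 1 - 2 * r * cos u + r\<^sup>2" for u using poisson_factor_pos[of r u] r by auto
  have pos: "1 - cos (t + p) > 0" "1 - cos (t - p) > 0"
    using cos_sum_diff_product[of t p] ne cos_le_one[of "t + p"] cos_le_one[of "t - p"]
    by (auto simp: less_le)
  have "2 * (ln \<bar>2 * cos t - 2 * cos p\<bar> - ln 4) = ln ((cos t - cos p)\<^sup>2 / 4)"
  proof -
    have "2 * cos t - 2 * cos p = 2 * (cos t - cos p)" by simp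
    then have "ln \<bar>2 * cos t - 2 * cos p\<bar> = ln 2 + ln \<bar>cos t - cos p\<bar>"
      using ne ln_mult_pos[of 2 "\<bar>cos t - cos p\<bar>"] by (simp only: abs_mult) simp
    moreover have "ln ((cos t - cos p)\<^sup>2) = 2 * ln \<bar>cos t - cos p\<bar>"
      using ne ln_realpow[of "\<bar>cos t - cos p\<bar>" 2] by simp
    moreover have "ln (4::real) = 2 * ln 2" using ln_realpow[of "2::real" 2] by simp
    ultimately show ?thesis using ne by (simp add: ln_div)
  qed
  also have "\<dots> = ln ((1 - cos (t + p)) / 2 * ((1 - cos (t - p)) / 2))"
    by (simp add: cos_sum_diff_product flip: cos_sum_diff_product)
  also have "\<dots> = ln ((1 - cos (t + p)) / 2) + ln ((1 - cos (t - p)) / 2)"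
    using pos by (intro ln_mult_pos) auto
  also have "\<dots> \<le> ln (1 - 2 * r * cos (t + p) + r\<^sup>2) + ln (1 - 2 * r * cos (t - p) + r\<^sup>2)"
    by (intro add_mono ln_mono f) (use p pos in auto)
  finally show ?thesis by (simp add: poisson_log_def)
qed

lemma poisson_log_tendsto:
  assumes r: "r \<longlonglongrightarrow> 1" and ne: "cos t \<noteq> cos p"
  shows "(\<lambda>j. poisson_log p (r j) t) \<longlonglongrightarrow> ln \<bar>2 * cos t - 2 * cos p\<bar>"
proof -
  have nz: "1 - cos (t + p) \<noteq> 0" "1 - cos (t - p) \<noteq> 0"
    using cos_sum_diff_product[of t p] ne by auto
  then have "(\<lambda>j. poisson_log p (r j) t) \<longlonglongrightarrow>
     ln (1 - 2 * 1 * cos (t + p) + 1\<^sup>2) / 2 + ln (1 - 2 * 1 * cos (t - p) + 1\<^sup>2) / 2"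
    unfolding poisson_log_def by (intro tendsto_intros r) auto
  also have "ln (1 - 2 * 1 * cos (t + p) + 1\<^sup>2) / 2 + ln (1 - 2 * 1 * cos (t - p) + 1\<^sup>2) / 2 =
     ln ((2 * (1 - cos (t + p))) * (2 * (1 - cos (t - p)))) / 2"
    using nz by (subst ln_mult_pos) (auto simp: algebra_simps add_divide_distrib less_le)
  also have "(2 * (1 - cos (t + p))) * (2 * (1 - cos (t - p))) = \<bar>2 * cos t - 2 * cos p\<bar>\<^sup>2"
    using cos_sum_diff_product[of t p] by (simp add: power2_eq_square algebra_simps)
  also have "ln (\<bar>2 * cos t - 2 * cos p\<bar>\<^sup>2) / 2 = ln \<bar>2 * cos t - 2 * cos p\<bar>"
    using ne by (subst ln_realpow) auto
  finally show ?thesis .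
qed

text \<open>Fatou's lemma along \<open>r \<rightarrow> 1\<close> gives integrability of the singular kernel for free,
  after which dominated convergence identifies its cosine moments.\<close>

lemma log_cos_integral:
  shows integrable_log_cos: "integrable angle_measure (\<lambda>t. ln \<bar>2 * cos t - 2 * cos p\<bar>)"
    and integral_log_cos: "(\<integral>t. ln \<bar>2 * cos t - 2 * cos p\<bar> * cos (real n * t) \<partial>angle_measure) =
      (if n = 0 then 0 else - (cos (real n * p) / real n))"
proof -
  interpret prob_space angle_measure by (rule prob_space_angle_measure)
  \<comment> \<open>The sequence 1 - 1/(j + 2) starts at 1/2, so the lower bound for r >= 1/4 is
    available for every j.\<close>
  define r where "r = (\<lambda>j. 1 - inverse (real (Suc (Suc j))))"
  have r: "1/4 \<le> r j" "0 \<le> r j" "r j < 1" for j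
    by (auto simp: r_def field_simps)
  have rlim: "r \<longlonglongrightarrow> 1"
    unfolding r_def using tendsto_diff[OF tendsto_const[of 1] LIMSEQ_Suc[OF LIMSEQ_inverse_real_of_nat]]
    by simp
  let ?L = "\<lambda>t. ln \<bar>2 * cos t - 2 * cos p\<bar>"
  let ?q = "\<lambda>j. poisson_log p (r j)"
  have qm [measurable]: "?q j \<in> borel_measurable borel" for j
    unfolding poisson_log_def by measurable
  have q0: "integrable angle_measure (?q j)" "integral\<^sup>L angle_measure (?q j) = 0" for j
    using integral_angle_measure[OF poisson_log_continuous[OF r(2,3)[of j]] qm[of j]]
      cosine_coeff_poisson_log[OF r(2,3), of p j 0]
    by (simp_all add: cosine_coeff_def)
  have "(\<integral>\<^sup>+t. ennreal (ln 4 - ?L t) \<partial>angle_measure) =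
      (\<integral>\<^sup>+t. liminf (\<lambda>j. ennreal (ln 4 - ?q j t)) \<partial>angle_measure)"
  proof (rule nn_integral_cong_AE)
    show "AE t in angle_measure. ennreal (ln 4 - ?L t) = liminf (\<lambda>j. ennreal (ln 4 - ?q j t))"
      using AE_angle_measure_cos_neq[of "cos p"]
    proof eventually_elim
      case (elim t)
      have "(\<lambda>j. ennreal (ln 4 - ?q j t)) \<longlonglongrightarrow> ennreal (ln 4 - ?L t)"
        by (intro tendsto_intros poisson_log_tendsto rlim elim)
      then show ?case by (simp add: lim_imp_Liminf)
    qed
  qed
  also have "\<dots> \<le> liminf (\<lambda>j. \<integral>\<^sup>+t. ennreal (ln 4 - ?q j t) \<partial>angle_measure)"
    by (rule nn_integral_liminf) measurable
  \<comment> \<open>Every regularised logarithm has mean 0, its cosine coefficient of index 0, so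
    these integrals do not depend on j.\<close>
  also have "\<dots> = ennreal (ln 4)"
  proof -
    have "(\<integral>\<^sup>+t. ennreal (ln 4 - ?q j t) \<partial>angle_measure) = ennreal (ln 4)" for j
      by (subst nn_integral_eq_integral)
         (auto intro!: Bochner_Integration.integrable_diff q0 simp: poisson_log_upper r q0 prob_space[simplified])
    then show ?thesis by (simp add: Liminf_const)
  qed
  finally have fin: "(\<integral>\<^sup>+t. ennreal (ln 4 - ?L t) \<partial>angle_measure) < \<infinity>"
    using le_less_trans by fastforce
  have Lub: "?L t \<le> ln 4" for t
  proof (cases "2 * cos t - 2 * cos p = 0")
    case False
    have "\<bar>2 * cos t - 2 * cos p\<bar> \<le> 4"
      using cos_ge_minus_one[of t] cos_ge_minus_one[of p] cos_le_one[of t] cos_le_one[of p] by linarith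
    then show ?thesis using False by (intro ln_mono) auto
  qed auto
  have "integrable angle_measure (\<lambda>t. ln 4 - ?L t)"
  proof (rule integrableI_bounded)
    show "(\<integral>\<^sup>+t. ennreal (norm (ln 4 - ?L t)) \<partial>angle_measure) < \<infinity>"
      using fin Lub by simp
  qed measurable
  then have "integrable angle_measure (\<lambda>t. ln 4 - (ln 4 - ?L t))"
    by (rule Bochner_Integration.integrable_diff[rotated]) simp
  then show int: "integrable angle_measure ?L" by (simp only: diff_diff_eq2 add_diff_cancel_left')
  have lim1: "(\<lambda>j. \<integral>t. ?q j t * cos (real n * t) \<partial>angle_measure) \<longlonglongrightarrow>
     (\<integral>t. ?L t * cos (real n * t) \<partial>angle_measure)"
  proof (rule integral_dominated_convergence)
    show "integrable angle_measure (\<lambda>t. 2 * ln 4 + \<bar>?L t\<bar>)"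
      by (intro Bochner_Integration.integrable_add integrable_abs int) auto
    show "AE t in angle_measure. (\<lambda>j. ?q j t * cos (real n * t)) \<longlonglongrightarrow> ?L t * cos (real n * t)"
      using AE_angle_measure_cos_neq[of "cos p"]
      by eventually_elim (intro tendsto_intros poisson_log_tendsto rlim)
    fix j
    show "AE t in angle_measure. norm (?q j t * cos (real n * t)) \<le> 2 * ln 4 + \<bar>?L t\<bar>"
      using AE_angle_measure_cos_neq[of "cos p"]
    proof eventually_elim
      case (elim t)
      have "\<bar>?q j t\<bar> \<le> 2 * ln 4 + \<bar>?L t\<bar>"
        using poisson_log_upper[OF r(2,3), of p j t] poisson_log_lower[OF r(1,3) elim, of j]
          ln_ge_zero[of "4::real"] by linarith
      moreover have "\<bar>?q j t\<bar> * \<bar>cos (real n * t)\<bar> \<le> \<bar>?q j t\<bar> * 1"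
        by (intro mult_left_mono) auto
      ultimately show ?case by (simp add: abs_mult)
    qed
  qed measurable
  have eq: "(\<integral>t. ?q j t * cos (real n * t) \<partial>angle_measure) =
     (if n = 0 then 0 else - (r j ^ n * cos (real n * p) / real n))" for j
    using cosine_coeff_eq_expectation[OF poisson_log_continuous[OF r(2,3)[of j]] qm[of j], of n]
      cosine_coeff_poisson_log[OF r(2,3), of p j n] by simp
  have lim2: "(\<lambda>j. if n = 0 then 0 else - (r j ^ n * cos (real n * p) / real n)) \<longlonglongrightarrow>
     (if n = 0 then 0 else - (1 ^ n * cos (real n * p) / real n))"
    by (cases "n = 0") (simp, simp only: if_False, intro tendsto_intros rlim, simp)
  show "(\<integral>t. ?L t * cos (real n * t) \<partial>angle_measure) =
      (if n = 0 then 0 else - (cos (real n * p) / real n))"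
    using LIMSEQ_unique[OF lim1[unfolded eq] lim2] by simp
qed

section \<open>First variation of a quadratic energy with values in [0, infinity]\<close>

section \<open>The Euler-Lagrange inequality for energies\<close>

text \<open>The convex combination of \<open>\<mu>\<close> with weight 1 - e and
  \<open>\<nu>\<close> with weight e, as the law of a two-stage draw; its integrals then follow from
  the rule for \<open>bind\<close>.\<close>

definition mixture :: "real \<Rightarrow> real measure \<Rightarrow> real measure \<Rightarrow> real measure" where
  "mixture e \<mu> \<nu> = measure_pmf (bernoulli_pmf e) \<bind> (\<lambda>x. if x then \<nu> else \<mu>)"

definition weighted_energy :: "(real \<Rightarrow> ennreal) \<Rightarrow> (real \<Rightarrow> real \<Rightarrow> ennreal) \<Rightarrow> real measure \<Rightarrow> ennreal" where
  "weighted_energy v k \<nu> = (\<integral>\<^sup>+x. v x \<partial>\<nu>) + (\<integral>\<^sup>+x. \<integral>\<^sup>+y. k x y \<partial>\<nu> \<partial>\<nu>)"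

text \<open>Up to an additive constant, the first variation of \<open>weighted_energy\<close> at
  \<open>\<mu>\<close> towards the unit mass at x; the 2 comes from the symmetric double integral.
  \<open>v x\<close> sits under the integral so that Fatou's lemma can treat the sum in one
  piece.\<close>

definition weighted_potential :: "(real \<Rightarrow> ennreal) \<Rightarrow> (real \<Rightarrow> real \<Rightarrow> ennreal) \<Rightarrow> real measure \<Rightarrow> real \<Rightarrow> ennreal" where
  "weighted_potential v k \<mu> x = (\<integral>\<^sup>+y. v x + 2 * k x y \<partial>\<mu>)"

lemma mixture_kernel_measurable:
  assumes "real_distribution \<mu>" "real_distribution \<nu>"
  shows "(\<lambda>x. if x then \<nu> else \<mu>) \<in> measurable (measure_pmf p) (subprob_algebra borel)"
proof -
  interpret m: real_distribution \<mu> by fact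
  interpret n: real_distribution \<nu> by fact
  show ?thesis
    by (auto simp: measurable_pmf_measure1 space_subprob_algebra m.subprob_space_axioms
        n.subprob_space_axioms)
qed

lemma nn_integral_mixture:
  assumes "real_distribution \<mu>" "real_distribution \<nu>" "0 \<le> e" "e \<le> 1"
    and f: "f \<in> borel_measurable borel"
  shows "(\<integral>\<^sup>+x. f x \<partial>mixture e \<mu> \<nu>) = ennreal (1 - e) * (\<integral>\<^sup>+x. f x \<partial>\<mu>) + ennreal e * (\<integral>\<^sup>+x. f x \<partial>\<nu>)"
  unfolding mixture_def nn_integral_bind[OF f mixture_kernel_measurable[OF assms(1,2)]]
  using assms(3,4) by (subst nn_integral_bernoulli_pmf) (auto simp: mult.commute add.commute)

lemma real_distribution_mixture:
  assumes "real_distribution \<mu>" "real_distribution \<nu>" "0 \<le> e" "e \<le> 1"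
  shows "real_distribution (mixture e \<mu> \<nu>)"
proof -
  interpret m: real_distribution \<mu> by fact
  interpret n: real_distribution \<nu> by fact
  have sets: "sets (mixture e \<mu> \<nu>) = sets borel"
    unfolding mixture_def by (rule sets_bind) auto
  then have "space (mixture e \<mu> \<nu>) = UNIV" by (metis sets_eq_imp_space_eq space_borel)
  moreover have "emeasure (mixture e \<mu> \<nu>) UNIV = 1"
  proof -
    have "emeasure (mixture e \<mu> \<nu>) UNIV = (\<integral>\<^sup>+x. 1 \<partial>mixture e \<mu> \<nu>)"
      using \<open>space (mixture e \<mu> \<nu>) = UNIV\<close> by simp
    also have "\<dots> = ennreal (1 - e) * (\<integral>\<^sup>+x. 1 \<partial>\<mu>) + ennreal e * (\<integral>\<^sup>+x. 1 \<partial>\<nu>)"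
      by (rule nn_integral_mixture[OF assms]) simp
    also have "\<dots> = 1"
      using assms(3,4) m.emeasure_space_1 n.emeasure_space_1 by (simp flip: ennreal_plus)
    finally show ?thesis .
  qed
  ultimately have "prob_space (mixture e \<mu> \<nu>)" by (intro prob_spaceI) simp
  then show ?thesis
    using sets by (simp add: real_distribution_def real_distribution_axioms_def)
qed

lemma AE_mixture:
  assumes "real_distribution \<mu>" "real_distribution \<nu>" "0 \<le> e" "e \<le> 1"
    and [measurable]: "K \<in> sets borel" and K: "AE x in \<mu>. x \<in> K" "AE x in \<nu>. x \<in> K"
  shows "AE x in mixture e \<mu> \<nu>. x \<in> K"
proof -
  interpret m: real_distribution \<mu> by fact
  interpret n: real_distribution \<nu> by fact
  interpret x: real_distribution "mixture e \<mu> \<nu>" by (rule real_distribution_mixture[OF assms(1-4)])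
  have "(\<integral>\<^sup>+x. indicator (- K) x \<partial>\<mu>) = 0" "(\<integral>\<^sup>+x. indicator (- K) x \<partial>\<nu>) = 0"
    using K by (subst nn_integral_0_iff_AE; simp add: indicator_def)+
  then have "(\<integral>\<^sup>+x. indicator (- K) x \<partial>mixture e \<mu> \<nu>) = 0"
    by (subst nn_integral_mixture[OF assms(1-4)]) auto
  then show ?thesis
    by (subst (asm) nn_integral_0_iff_AE) (auto simp: indicator_def split: if_splits)
qed

lemma quadratic_at_zero_nonneg:
  fixes F D :: real
  assumes "\<And>e. 0 < e \<Longrightarrow> e < 1 \<Longrightarrow> 0 \<le> e * F + e\<^sup>2 * D"
  shows "0 \<le> F"
proof (rule ccontr)
  assume "\<not> 0 \<le> F"
  then have F: "F < 0" by simp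
  \<comment> \<open>Chosen below 1 and so small that e |D| is at most - F / 2; then F + e D is still
    negative.\<close>
  define e where "e = - F / (2 * (\<bar>D\<bar> - F + 1))"
  have e: "0 < e" "e < 1" using F by (auto simp: e_def field_simps)
  have "e * \<bar>D\<bar> \<le> - F / 2"
    using F by (simp add: e_def field_simps mult_nonneg_nonneg mult_nonpos_nonneg)
  moreover have "e * D \<le> e * \<bar>D\<bar>" using e by (intro mult_left_mono) auto
  ultimately have "e * D < - F" using F by linarith
  then have "e * (F + e * D) < 0" using e by (intro mult_pos_neg) auto
  then show False using assms[OF e] by (simp add: power2_eq_square algebra_simps)
qed

text \<open>Values in [0, infinity] give every integral a meaning without integrability conditions.
  A shifted logarithm is nonnegative only on a bounded set, so competitors will be confined to
  K.\<close>

locale energy_kernel =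
  fixes v :: "real \<Rightarrow> ennreal" and k :: "real \<Rightarrow> real \<Rightarrow> ennreal" and K :: "real set"
  assumes v_measurable [measurable]: "v \<in> borel_measurable borel"
    and k_measurable [measurable]: "case_prod k \<in> borel_measurable (borel \<Otimes>\<^sub>M borel)"
    and k_commute: "k x y = k y x"
    and K_measurable [measurable]: "K \<in> sets borel"
begin

lemma potential_measurable:
  assumes "real_distribution \<mu>"
  shows "(\<lambda>x. \<integral>\<^sup>+y. k x y \<partial>\<mu>) \<in> borel_measurable borel"
    and "weighted_potential v k \<mu> \<in> borel_measurable borel"
proof -
  interpret real_distribution \<mu> by fact
  show "(\<lambda>x. \<integral>\<^sup>+y. k x y \<partial>\<mu>) \<in> borel_measurable borel"
    by measurable
  show "weighted_potential v k \<mu> \<in> borel_measurable borel"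
    unfolding weighted_potential_def[abs_def] by measurable
qed

lemma weighted_potential_eq:
  assumes "real_distribution \<mu>"
  shows "weighted_potential v k \<mu> x = v x + 2 * (\<integral>\<^sup>+y. k x y \<partial>\<mu>)"
proof -
  interpret real_distribution \<mu> by fact
  have "weighted_potential v k \<mu> x = (\<integral>\<^sup>+y. v x \<partial>\<mu>) + (\<integral>\<^sup>+y. 2 * k x y \<partial>\<mu>)"
    unfolding weighted_potential_def by (rule nn_integral_add) measurable
  also have "(\<integral>\<^sup>+y. 2 * k x y \<partial>\<mu>) = 2 * (\<integral>\<^sup>+y. k x y \<partial>\<mu>)"
    by (rule nn_integral_cmult) measurable
  finally show ?thesis by (simp add: emeasure_space_1[simplified])
qed

lemma nn_integral_weighted_potential:
  assumes "real_distribution \<mu>" "real_distribution \<nu>"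
  shows "(\<integral>\<^sup>+x. weighted_potential v k \<mu> x \<partial>\<nu>) = (\<integral>\<^sup>+x. v x \<partial>\<nu>) + 2 * (\<integral>\<^sup>+x. \<integral>\<^sup>+y. k x y \<partial>\<mu> \<partial>\<nu>)"
proof -
  interpret n: real_distribution \<nu> by fact
  note [measurable] = potential_measurable[OF assms(1)]
  show ?thesis
    unfolding weighted_potential_eq[OF assms(1)]
    by (subst nn_integral_add) (auto simp: nn_integral_cmult)
qed

lemma cross_energy_commute:
  assumes "real_distribution \<mu>" "real_distribution \<nu>"
  shows "(\<integral>\<^sup>+x. \<integral>\<^sup>+y. k x y \<partial>\<mu> \<partial>\<nu>) = (\<integral>\<^sup>+x. \<integral>\<^sup>+y. k x y \<partial>\<nu> \<partial>\<mu>)"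
proof -
  interpret m: real_distribution \<mu> by fact
  interpret n: real_distribution \<nu> by fact
  interpret pair_sigma_finite \<mu> \<nu> by unfold_locales
  have "(\<integral>\<^sup>+x. \<integral>\<^sup>+y. k y x \<partial>\<mu> \<partial>\<nu>) = (\<integral>\<^sup>+x. \<integral>\<^sup>+y. k x y \<partial>\<nu> \<partial>\<mu>)"
    by (rule Fubini') measurable
  then show ?thesis by (simp add: k_commute)
qed

lemma weighted_energy_mixture:
  assumes m: "real_distribution \<mu>" and n: "real_distribution \<nu>" and e: "0 \<le> e" "e \<le> 1"
  shows "weighted_energy v k (mixture e \<mu> \<nu>) =
     ennreal (1 - e) * (\<integral>\<^sup>+x. v x \<partial>\<mu>) + ennreal e * (\<integral>\<^sup>+x. v x \<partial>\<nu>) +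
     (ennreal (1 - e) * (ennreal (1 - e) * (\<integral>\<^sup>+x. \<integral>\<^sup>+y. k x y \<partial>\<mu> \<partial>\<mu>) + ennreal e * (\<integral>\<^sup>+x. \<integral>\<^sup>+y. k x y \<partial>\<mu> \<partial>\<nu>)) +
      ennreal e * (ennreal (1 - e) * (\<integral>\<^sup>+x. \<integral>\<^sup>+y. k x y \<partial>\<mu> \<partial>\<nu>) + ennreal e * (\<integral>\<^sup>+x. \<integral>\<^sup>+y. k x y \<partial>\<nu> \<partial>\<nu>)))"
proof -
  interpret m: real_distribution \<mu> by fact
  interpret n: real_distribution \<nu> by fact
  note [measurable] = potential_measurable[OF m] potential_measurable[OF n]
  have inner: "(\<integral>\<^sup>+y. k x y \<partial>mixture e \<mu> \<nu>) = ennreal (1 - e) * (\<integral>\<^sup>+y. k x y \<partial>\<mu>) + ennreal e * (\<integral>\<^sup>+y. k x y \<partial>\<nu>)" for x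
    by (rule nn_integral_mixture[OF m n e]) measurable
  have "(\<integral>\<^sup>+x. \<integral>\<^sup>+y. k x y \<partial>mixture e \<mu> \<nu> \<partial>\<rho>) =
      ennreal (1 - e) * (\<integral>\<^sup>+x. \<integral>\<^sup>+y. k x y \<partial>\<mu> \<partial>\<rho>) + ennreal e * (\<integral>\<^sup>+x. \<integral>\<^sup>+y. k x y \<partial>\<nu> \<partial>\<rho>)"
    if [measurable_cong]: "sets \<rho> = sets borel" for \<rho>
    unfolding inner by (subst nn_integral_add) (auto simp: nn_integral_cmult)
  from this[of \<mu>] this[of \<nu>] show ?thesis
    unfolding weighted_energy_def
    by (subst nn_integral_mixture[OF m n e], measurable)
       (subst nn_integral_mixture[OF m n e], auto simp: inner cross_energy_commute[OF n m])
qed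

text \<open>Along the mixtures of weight e the energy is a quadratic polynomial in e that is
  smallest at e = 0, so its linear coefficient is nonnegative; that coefficient is the difference of
  the two sides.\<close>

lemma minimizer_weighted_potential_le:
  assumes m: "real_distribution \<mu>" and n: "real_distribution \<nu>"
    and mK: "AE x in \<mu>. x \<in> K" and nK: "AE x in \<nu>. x \<in> K"
    and min: "\<And>\<rho>. real_distribution \<rho> \<Longrightarrow> AE x in \<rho>. x \<in> K \<Longrightarrow> weighted_energy v k \<mu> \<le> weighted_energy v k \<rho>"
    and fm: "weighted_energy v k \<mu> < \<infinity>" and fn: "(\<integral>\<^sup>+x. \<integral>\<^sup>+y. k x y \<partial>\<nu> \<partial>\<nu>) < \<infinity>"
  shows "(\<integral>\<^sup>+x. weighted_potential v k \<mu> x \<partial>\<mu>) \<le> (\<integral>\<^sup>+x. weighted_potential v k \<mu> x \<partial>\<nu>)"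
proof (cases "(\<integral>\<^sup>+x. weighted_potential v k \<mu> x \<partial>\<nu>) = \<infinity>")
  case False
  \<comment> \<open>With a finite right side all five integrals in the polynomial are finite; only
    then can they be subtracted as real numbers.\<close>
  then have "(\<integral>\<^sup>+x. v x \<partial>\<nu>) < \<infinity>" "(\<integral>\<^sup>+x. \<integral>\<^sup>+y. k x y \<partial>\<mu> \<partial>\<nu>) < \<infinity>"
    unfolding nn_integral_weighted_potential[OF m n]
    by (auto simp: less_top ennreal_mult_eq_top_iff)
  moreover have "(\<integral>\<^sup>+x. v x \<partial>\<mu>) < \<infinity>" "(\<integral>\<^sup>+x. \<integral>\<^sup>+y. k x y \<partial>\<mu> \<partial>\<mu>) < \<infinity>"
    using fm by (auto simp: weighted_energy_def less_top)
  ultimately have fin: "(\<integral>\<^sup>+x. v x \<partial>\<mu>) < top" "(\<integral>\<^sup>+x. v x \<partial>\<nu>) < top"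
      "(\<integral>\<^sup>+x. \<integral>\<^sup>+y. k x y \<partial>\<mu> \<partial>\<mu>) < top" "(\<integral>\<^sup>+x. \<integral>\<^sup>+y. k x y \<partial>\<mu> \<partial>\<nu>) < top"
      "(\<integral>\<^sup>+x. \<integral>\<^sup>+y. k x y \<partial>\<nu> \<partial>\<nu>) < top"
    using fn by simp_all
  define vm where "vm = enn2real (\<integral>\<^sup>+x. v x \<partial>\<mu>)"
  define vn where "vn = enn2real (\<integral>\<^sup>+x. v x \<partial>\<nu>)"
  define kmm where "kmm = enn2real (\<integral>\<^sup>+x. \<integral>\<^sup>+y. k x y \<partial>\<mu> \<partial>\<mu>)"
  define kmn where "kmn = enn2real (\<integral>\<^sup>+x. \<integral>\<^sup>+y. k x y \<partial>\<mu> \<partial>\<nu>)"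
  define knn where "knn = enn2real (\<integral>\<^sup>+x. \<integral>\<^sup>+y. k x y \<partial>\<nu> \<partial>\<nu>)"
  note eqs = fin[THEN ennreal_enn2real, folded vm_def vn_def kmm_def kmn_def knn_def, symmetric]
  have nonneg: "0 \<le> vm" "0 \<le> vn" "0 \<le> kmm" "0 \<le> kmn" "0 \<le> knn"
    by (simp_all add: vm_def vn_def kmm_def kmn_def knn_def)
  have "0 \<le> e * ((vn - vm) + 2 * (kmn - kmm)) + e\<^sup>2 * (kmm - 2 * kmn + knn)" if e: "0 < e" "e < 1" for e
  proof -
    have "weighted_energy v k \<mu> \<le> weighted_energy v k (mixture e \<mu> \<nu>)"
      using e by (intro min real_distribution_mixture AE_mixture m n mK nK) auto
    then have "ennreal (vm + kmm) \<le> ennreal ((1 - e) * vm + e * vn +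
        ((1 - e) * ((1 - e) * kmm + e * kmn) + e * ((1 - e) * kmn + e * knn)))"
      using e nonneg
      by (subst (asm) weighted_energy_mixture[OF m n]) (auto simp: weighted_energy_def eqs ennreal_mult)
    then have "vm + kmm \<le> (1 - e) * vm + e * vn +
        ((1 - e) * ((1 - e) * kmm + e * kmn) + e * ((1 - e) * kmn + e * knn))"
      using e nonneg by (subst (asm) ennreal_le_iff) auto
    then show ?thesis by (simp add: power2_eq_square algebra_simps)
  qed
  then have "0 \<le> (vn - vm) + 2 * (kmn - kmm)" by (rule quadratic_at_zero_nonneg)
  then have "ennreal (vm + 2 * kmm) \<le> ennreal (vn + 2 * kmn)"
    by (intro ennreal_leI) simp
  then show ?thesis
    unfolding nn_integral_weighted_potential[OF m n] nn_integral_weighted_potential[OF m m] eqs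
    using nonneg by (simp add: ennreal_mult)
qed simp

text \<open>Normalising the restriction of the minimiser to the sublevel set of its potential gives
  a competitor whose mean potential is too small unless that set has full measure.\<close>

lemma minimizer_weighted_potential_AE_le:
  assumes m: "real_distribution \<mu>" and mK: "AE x in \<mu>. x \<in> K"
    and min: "\<And>\<rho>. real_distribution \<rho> \<Longrightarrow> AE x in \<rho>. x \<in> K \<Longrightarrow> weighted_energy v k \<mu> \<le> weighted_energy v k \<rho>"
    and fm: "weighted_energy v k \<mu> < \<infinity>"
  shows "AE x in \<mu>. weighted_potential v k \<mu> x \<le> (\<integral>\<^sup>+x. weighted_potential v k \<mu> x \<partial>\<mu>)"
proof (rule ccontr)
  assume notAE: "\<not> ?thesis"
  interpret m: real_distribution \<mu> by fact
  note [measurable] = potential_measurable[OF m]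
  let ?\<Phi> = "weighted_potential v k \<mu>"
  define C where "C = (\<integral>\<^sup>+x. ?\<Phi> x \<partial>\<mu>)"
  define A where "A = {x. ?\<Phi> x \<le> C}"
  have A [measurable]: "A \<in> sets borel" unfolding A_def by measurable
  have kfin: "(\<integral>\<^sup>+x. \<integral>\<^sup>+y. k x y \<partial>\<mu> \<partial>\<mu>) < \<infinity>" and Cfin: "C < \<infinity>"
    using fm by (auto simp: weighted_energy_def C_def nn_integral_weighted_potential[OF m m]
        less_top[symmetric] ennreal_mult_eq_top_iff)
  have less: "C * emeasure \<mu> (- A) < (\<integral>\<^sup>+x. ?\<Phi> x * indicator (- A) x \<partial>\<mu>)"
  proof -
    have "(\<integral>\<^sup>+x. C * indicator (- A) x \<partial>\<mu>) < (\<integral>\<^sup>+x. ?\<Phi> x * indicator (- A) x \<partial>\<mu>)"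
    proof (rule nn_integral_less)
      show "(\<integral>\<^sup>+x. C * indicator (- A) x \<partial>\<mu>) \<noteq> \<infinity>"
        using Cfin m.emeasure_finite[of "- A"]
        by (subst nn_integral_cmult_indicator) (auto simp: ennreal_mult_eq_top_iff less_top)
      show "AE x in \<mu>. C * indicator (- A) x \<le> ?\<Phi> x * indicator (- A) x"
        by (intro AE_I2) (auto simp: A_def indicator_def)
      show "\<not> (AE x in \<mu>. ?\<Phi> x * indicator (- A) x \<le> C * indicator (- A) x)"
      proof
        assume "AE x in \<mu>. ?\<Phi> x * indicator (- A) x \<le> C * indicator (- A) x"
        then have "AE x in \<mu>. ?\<Phi> x \<le> C"
        proof eventually_elim
          case (elim x)
          then show ?case by (cases "x \<in> A") (simp add: A_def, simp)
        qed
        then show False using notAE by (simp add: C_def)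
      qed
    qed measurable
    then show ?thesis by (subst (asm) nn_integral_cmult_indicator) auto
  qed
  have split: "C = (\<integral>\<^sup>+x. ?\<Phi> x * indicator A x \<partial>\<mu>) + (\<integral>\<^sup>+x. ?\<Phi> x * indicator (- A) x \<partial>\<mu>)"
    unfolding C_def by (subst nn_integral_add[symmetric]) (auto intro!: nn_integral_cong simp: indicator_def)
  have one: "emeasure \<mu> A + emeasure \<mu> (- A) = 1"
    using m.emeasure_space_1 by (subst plus_emeasure) (auto simp: Compl_partition)
  have "C * emeasure \<mu> A \<le> (\<integral>\<^sup>+x. ?\<Phi> x * indicator A x \<partial>\<mu>)"
  proof (cases "emeasure \<mu> A = 0")
    case False
    let ?\<nu> = "uniform_measure \<mu> A"
    have n: "real_distribution ?\<nu>"
      unfolding real_distribution_def real_distribution_axioms_def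
      using False m.emeasure_finite[of A] by (auto intro!: prob_space_uniform_measure)
    interpret n: real_distribution ?\<nu> by fact
    have nK: "AE x in ?\<nu>. x \<in> K"
      using mK by (intro AE_uniform_measureI) auto
    \<comment> \<open>The conditioned measure is dominated by \<open>\<mu>\<close> divided by the
      mass of A, so its kernel energy is finite, as a competitor must have.\<close>
    have le: "(\<integral>\<^sup>+x. f x \<partial>?\<nu>) \<le> (\<integral>\<^sup>+x. f x \<partial>\<mu>) / emeasure \<mu> A"
      if [measurable]: "f \<in> borel_measurable borel" for f
      by (subst nn_integral_uniform_measure)
         (auto intro!: divide_right_mono_ennreal nn_integral_mono simp: indicator_def)
    have "(\<integral>\<^sup>+x. \<integral>\<^sup>+y. k x y \<partial>?\<nu> \<partial>?\<nu>) \<le> (\<integral>\<^sup>+x. (\<integral>\<^sup>+y. k x y \<partial>\<mu>) / emeasure \<mu> A \<partial>?\<nu>)"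
      by (intro nn_integral_mono le) measurable
    also have "\<dots> \<le> (\<integral>\<^sup>+x. (\<integral>\<^sup>+y. k x y \<partial>\<mu>) / emeasure \<mu> A \<partial>\<mu>) / emeasure \<mu> A"
      by (rule le) measurable
    also have "\<dots> = (\<integral>\<^sup>+x. (\<integral>\<^sup>+y. k x y \<partial>\<mu>) \<partial>\<mu>) / emeasure \<mu> A / emeasure \<mu> A"
      by (subst nn_integral_divide) auto
    also have "\<dots> < \<infinity>"
      using kfin False by (auto simp: ennreal_divide_eq_top_iff less_top[symmetric])
    finally have fn: "(\<integral>\<^sup>+x. \<integral>\<^sup>+y. k x y \<partial>?\<nu> \<partial>?\<nu>) < \<infinity>" .
    have "C \<le> (\<integral>\<^sup>+x. ?\<Phi> x \<partial>?\<nu>)"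
      unfolding C_def by (rule minimizer_weighted_potential_le[OF m n mK nK min fm fn])
    also have "\<dots> = (\<integral>\<^sup>+x. ?\<Phi> x * indicator A x \<partial>\<mu>) / emeasure \<mu> A"
      by (rule nn_integral_uniform_measure) measurable
    finally have "C * emeasure \<mu> A \<le> (\<integral>\<^sup>+x. ?\<Phi> x * indicator A x \<partial>\<mu>) / emeasure \<mu> A * emeasure \<mu> A"
      by (rule mult_right_mono) simp
    also have "\<dots> = (\<integral>\<^sup>+x. ?\<Phi> x * indicator A x \<partial>\<mu>)"
      using False m.emeasure_finite[of A] by (simp add: ennreal_divide_times ennreal_divide_self less_top[symmetric])
    finally show ?thesis .
  qed simp
  \<comment> \<open>The part over A is at least C times its mass, and the part off A strictly
    exceeds C times its mass; yet the two parts add up to C.\<close>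
  then have "C * emeasure \<mu> A + (\<integral>\<^sup>+x. ?\<Phi> x * indicator (- A) x \<partial>\<mu>) \<le> C"
    by (subst (2) split) (rule add_right_mono)
  moreover have "C * emeasure \<mu> A + C * emeasure \<mu> (- A) <
      C * emeasure \<mu> A + (\<integral>\<^sup>+x. ?\<Phi> x * indicator (- A) x \<partial>\<mu>)"
    using less Cfin m.emeasure_finite[of A]
    by (auto simp: ennreal_add_left_cancel_less ennreal_mult_eq_top_iff)
  ultimately have "C * emeasure \<mu> A + C * emeasure \<mu> (- A) < C" by order
  then have "C * (emeasure \<mu> A + emeasure \<mu> (- A)) < C" by (simp only: distrib_left)
  then show False by (simp add: one)
qed

text \<open>Every neighbourhood of a point of the support has positive mass, hence contains points where
  the almost everywhere bound holds; Fatou's lemma passes it to the limit.\<close>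

lemma minimizer_weighted_potential_support_le:
  assumes m: "real_distribution \<mu>" and mK: "AE x in \<mu>. x \<in> K"
    and min: "\<And>\<rho>. real_distribution \<rho> \<Longrightarrow> AE x in \<rho>. x \<in> K \<Longrightarrow> weighted_energy v k \<mu> \<le> weighted_energy v k \<rho>"
    and fm: "weighted_energy v k \<mu> < \<infinity>"
    and cont: "\<And>x X y. X \<longlonglongrightarrow> x \<Longrightarrow> (\<lambda>n. v (X n) + 2 * k (X n) y) \<longlonglongrightarrow> v x + 2 * k x y"
    and x: "x \<in> measure_support \<mu>"
  shows "weighted_potential v k \<mu> x \<le> (\<integral>\<^sup>+x. weighted_potential v k \<mu> x \<partial>\<mu>)" (is "_ \<le> ?C")
proof -
  interpret m: real_distribution \<mu> by fact
  have ae: "AE x in \<mu>. weighted_potential v k \<mu> x \<le> ?C"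
    by (rule minimizer_weighted_potential_AE_le[OF m mK min fm])
  have "\<exists>y\<in>ball x (inverse (real (Suc n))). weighted_potential v k \<mu> y \<le> ?C" for n
  proof (rule ccontr)
    assume none: "\<not> ?thesis"
    have "AE y in \<mu>. y \<notin> ball x (inverse (real (Suc n)))"
      using ae by eventually_elim (use none in blast)
    then have "emeasure \<mu> (ball x (inverse (real (Suc n)))) = 0"
      by (subst (asm) AE_iff_measurable[OF _ refl]) (auto simp: ball_def)
    moreover have "emeasure \<mu> (ball x (inverse (real (Suc n)))) > 0"
      using x by (auto simp: measure_support_def)
    ultimately show False by simp
  qed
  then obtain X where X: "\<And>n. X n \<in> ball x (inverse (real (Suc n)))"
      "\<And>n. weighted_potential v k \<mu> (X n) \<le> ?C"
    by metis
  have "X \<longlonglongrightarrow> x"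
  proof (rule tendstoI)
    fix e :: real assume "e > 0"
    then have "\<forall>\<^sub>F n in sequentially. inverse (real (Suc n)) < e"
      using LIMSEQ_inverse_real_of_nat order_tendstoD(2) by blast
    then show "\<forall>\<^sub>F n in sequentially. dist (X n) x < e"
      by eventually_elim (use X(1) in \<open>auto simp: dist_commute intro: less_trans\<close>)
  qed
  then have "weighted_potential v k \<mu> x = (\<integral>\<^sup>+y. liminf (\<lambda>n. v (X n) + 2 * k (X n) y) \<partial>\<mu>)"
    unfolding weighted_potential_def
    by (intro nn_integral_cong lim_imp_Liminf[symmetric] cont) auto
  also have "\<dots> \<le> liminf (\<lambda>n. weighted_potential v k \<mu> (X n))"
    unfolding weighted_potential_def by (rule nn_integral_liminf) measurable
  also have "\<dots> \<le> liminf (\<lambda>n. ?C)"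
    by (intro Liminf_mono always_eventually allI X(2))
  finally show ?thesis by (simp add: Liminf_const)
qed

end

section \<open>Nonnegative form of the logarithmic energy; the arcsine law as a competitor\<close>

section \<open>Logarithmic energies\<close>

text \<open>The diagonal is set explicitly because \<open>ln 0 = 0\<close> would make point masses
  cheap. \<open>ennreal\<close> truncates negative numbers, so off the diagonal this represents
  \<open>R - ln |x - y|\<close> only where |x - y| <= exp R.\<close>

definition log_kernel :: "real \<Rightarrow> real \<Rightarrow> real \<Rightarrow> ennreal" where
  "log_kernel R x y = (if x = y then \<top> else ennreal (R - ln \<bar>x - y\<bar>))"

lemma log_kernel_measurable [measurable]:
  "case_prod (log_kernel R) \<in> borel_measurable (borel \<Otimes>\<^sub>M borel)"
  unfolding log_kernel_def split_beta by measurable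

lemma log_kernel_commute: "log_kernel R x y = log_kernel R y x"
  by (simp add: log_kernel_def abs_minus_commute)

text \<open>The kernel is continuous into [0, infinity] even at the diagonal, where it blows up;
  this supplies the continuity assumption of the bound on the support.\<close>

lemma log_kernel_tendsto:
  assumes X: "X \<longlonglongrightarrow> x"
  shows "(\<lambda>n. log_kernel R (X n) y) \<longlonglongrightarrow> log_kernel R x y"
proof (cases "x = y")
  case True
  have "\<forall>\<^sub>F n in sequentially. ennreal l < log_kernel R (X n) y" for l
  proof -
    \<comment> \<open>Within this distance \<open>R - ln |X n - y|\<close> exceeds |l| + 1, hence
      the level \<open>l\<close> of either sign.\<close>
    have "\<forall>\<^sub>F n in sequentially. dist (X n) y < exp (R - \<bar>l\<bar> - 1)"
      using tendstoD[OF X, of "exp (R - \<bar>l\<bar> - 1)"] True by simp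
    then show ?thesis
    proof eventually_elim
      case (elim n)
      show ?case
      proof (cases "X n = y")
        case False
        then have "ln \<bar>X n - y\<bar> < R - \<bar>l\<bar> - 1"
          using elim ln_less_cancel_iff[of "\<bar>X n - y\<bar>" "exp (R - \<bar>l\<bar> - 1)"]
          by (simp add: dist_real_def)
        then have "ennreal l < ennreal (R - ln \<bar>X n - y\<bar>)"
          by (intro ennreal_lessI) auto
        then show ?thesis using False by (simp add: log_kernel_def)
      qed (simp add: log_kernel_def)
    qed
  qed
  then show ?thesis
    using True by (simp add: log_kernel_def tendsto_top_iff_ennreal)
next
  case False
  then have "\<forall>\<^sub>F n in sequentially. X n \<noteq> y"
    using X by (rule tendsto_imp_eventually_ne[rotated])
  then have "\<forall>\<^sub>F n in sequentially. ennreal (R - ln \<bar>X n - y\<bar>) = log_kernel R (X n) y"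
    by eventually_elim (simp add: log_kernel_def)
  moreover have "(\<lambda>n. ennreal (R - ln \<bar>X n - y\<bar>)) \<longlonglongrightarrow> ennreal (R - ln \<bar>x - y\<bar>)"
    using False by (intro tendsto_intros X) auto
  ultimately show ?thesis
    using False by (simp add: log_kernel_def[of R x] tendsto_cong)
qed

lemma ext_integral_eq_integral:
  fixes f :: "'a \<Rightarrow> real"
  assumes "integrable M f"
  shows "ext_integral M (\<lambda>x. ereal (f x)) = ereal (integral\<^sup>L M f)"
proof -
  have fin: "(\<integral>\<^sup>+x. ennreal (f x) \<partial>M) < \<top>" "(\<integral>\<^sup>+x. ennreal (- f x) \<partial>M) < \<top>"
    using assms by (auto simp: real_integrable_def less_top)
  have e: "e2ennreal (ereal (f x)) = ennreal (f x)" "e2ennreal (- ereal (f x)) = ennreal (- f x)" for x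
    by (simp_all add: ennreal.abs_eq[symmetric])
  have "ext_integral M (\<lambda>x. ereal (f x)) =
      enn2ereal (\<integral>\<^sup>+x. ennreal (f x) \<partial>M) - enn2ereal (\<integral>\<^sup>+x. ennreal (- f x) \<partial>M)"
    unfolding ext_integral_def e by (rule refl)
  also have "enn2ereal (\<integral>\<^sup>+x. ennreal (f x) \<partial>M) = ereal (enn2real (\<integral>\<^sup>+x. ennreal (f x) \<partial>M))"
    by (subst ennreal_enn2real[OF fin(1), symmetric]) (simp add: enn2ereal_ennreal)
  also have "enn2ereal (\<integral>\<^sup>+x. ennreal (- f x) \<partial>M) = ereal (enn2real (\<integral>\<^sup>+x. ennreal (- f x) \<partial>M))"
    by (subst ennreal_enn2real[OF fin(2), symmetric]) (simp add: enn2ereal_ennreal)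
  finally show ?thesis
    using assms by (simp add: real_lebesgue_integral_def)
qed

text \<open>Every point outside the support has an open null neighbourhood; the Lindelof property
  reduces the union of these to a countable one.\<close>

lemma AE_measure_support:
  assumes "real_distribution \<mu>"
  shows "AE x in \<mu>. x \<in> measure_support \<mu>"
proof -
  interpret real_distribution \<mu> by fact
  let ?F = "{U. open U \<and> emeasure \<mu> U = 0}"
  obtain F' where F': "F' \<subseteq> ?F" "countable F'" "\<Union>F' = \<Union>?F"
    using Lindelof[of ?F] by auto
  have "AE x in \<mu>. \<forall>U\<in>F'. x \<notin> U"
  proof (subst AE_ball_countable[OF F'(2)], intro ballI)
    fix U assume "U \<in> F'"
    then have "U \<in> null_sets \<mu>" using F'(1) by (auto intro!: null_setsI)
    then show "AE x in \<mu>. x \<notin> U" by (rule AE_not_in)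
  qed
  then show ?thesis
  proof eventually_elim
    case (elim x)
    then have "x \<notin> \<Union>?F" using F'(3) by auto
    then show ?case by (auto simp: measure_support_def zero_less_iff_neq_zero)
  qed
qed

text \<open>For L <= R one has (R - L) + L^+ = R + L^- pointwise, also on the diagonal where both
  sides are infinite. Integrating this sum avoids subtracting infinities; the integral of L^+ is at
  most R, so it can be moved across afterwards.\<close>

lemma ext_integral_ext_ln:
  assumes "real_distribution \<nu>" and K: "AE x in \<nu>. x \<in> {l..u}"
    and R: "0 \<le> R" "u - l \<le> exp R"
  shows "ext_integral (\<nu> \<Otimes>\<^sub>M \<nu>) (\<lambda>(x, y). ext_ln \<bar>x - y\<bar>) =
    ereal R - enn2ereal (\<integral>\<^sup>+x. \<integral>\<^sup>+y. log_kernel R x y \<partial>\<nu> \<partial>\<nu>)"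
proof -
  interpret real_distribution \<nu> by fact
  interpret P: pair_prob_space \<nu> \<nu> by unfold_locales
  let ?L = "\<lambda>z. ext_ln \<bar>fst z - snd z\<bar>"
  have [measurable]: "(\<lambda>z. ext_ln \<bar>fst z - snd z\<bar>) \<in> borel_measurable (borel \<Otimes>\<^sub>M borel)"
    unfolding ext_ln_def by measurable
  let ?p = "\<integral>\<^sup>+z. e2ennreal (?L z) \<partial>(\<nu> \<Otimes>\<^sub>M \<nu>)"
  let ?n = "\<integral>\<^sup>+z. e2ennreal (- ?L z) \<partial>(\<nu> \<Otimes>\<^sub>M \<nu>)"
  let ?k = "\<integral>\<^sup>+z. log_kernel R (fst z) (snd z) \<partial>(\<nu> \<Otimes>\<^sub>M \<nu>)"
  have k: "?k = (\<integral>\<^sup>+x. \<integral>\<^sup>+y. log_kernel R x y \<partial>\<nu> \<partial>\<nu>)"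
    by (subst nn_integral_fst[symmetric]) auto
  have ae: "AE z in \<nu> \<Otimes>\<^sub>M \<nu>. fst z \<in> {l..u} \<and> snd z \<in> {l..u}"
  proof (rule P.AE_pair_measure)
    show "{z \<in> space (\<nu> \<Otimes>\<^sub>M \<nu>). fst z \<in> {l..u} \<and> snd z \<in> {l..u}} \<in> sets (\<nu> \<Otimes>\<^sub>M \<nu>)"
      by measurable
    show "AE x in \<nu>. AE y in \<nu>. fst (x, y) \<in> {l..u} \<and> snd (x, y) \<in> {l..u}"
      using K by eventually_elim (use K in auto)
  qed
  have lnR: "ln \<bar>x - y\<bar> \<le> R" if "x \<in> {l..u}" "y \<in> {l..u}" "x \<noteq> y" for x y
  proof -
    have "\<bar>x - y\<bar> \<le> exp R" using that R(2) by (auto simp: abs_le_iff)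
    then have "ln \<bar>x - y\<bar> \<le> ln (exp R)" using that by (intro ln_mono) auto
    then show ?thesis by simp
  qed
  have ext: "e2ennreal (ext_ln \<bar>x - y\<bar>) = ennreal (ln \<bar>x - y\<bar>)"
    "e2ennreal (- ext_ln \<bar>x - y\<bar>) = ennreal (- ln \<bar>x - y\<bar>)" if "x \<noteq> y" for x y
    using that by (simp_all add: ext_ln_def ennreal.abs_eq[symmetric])
  have ext0: "e2ennreal (ext_ln 0) = 0" "e2ennreal (- ext_ln 0) = \<top>"
    by (simp_all add: ext_ln_def e2ennreal_neg e2ennreal_infty)
  have "?k + ?p = (\<integral>\<^sup>+z. log_kernel R (fst z) (snd z) + e2ennreal (?L z) \<partial>(\<nu> \<Otimes>\<^sub>M \<nu>))"
    by (subst nn_integral_add) auto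
  also have "\<dots> = (\<integral>\<^sup>+z. ennreal R + e2ennreal (- ?L z) \<partial>(\<nu> \<Otimes>\<^sub>M \<nu>))"
  proof (rule nn_integral_cong_AE, use ae in eventually_elim)
    case (elim z)
    show ?case
    proof (cases "fst z = snd z")
      case True
      then show ?thesis by (simp add: log_kernel_def ext0)
    next
      case False
      let ?d = "ln \<bar>fst z - snd z\<bar>"
      have d: "?d \<le> R" using lnR elim False by blast
      have "ennreal (R - ?d) + ennreal ?d = ennreal R + ennreal (- ?d)"
        using d R(1) by (cases "?d \<ge> 0") (auto simp: ennreal_neg simp flip: ennreal_plus)
      then show ?thesis using False by (simp add: log_kernel_def ext)
    qed
  qed
  also have "\<dots> = ennreal R + ?n"
    by (subst nn_integral_add) (auto simp: P.emeasure_space_1)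
  finally have eq: "?k + ?p = ennreal R + ?n" .
  have "?p \<le> (\<integral>\<^sup>+z. ennreal R \<partial>(\<nu> \<Otimes>\<^sub>M \<nu>))"
  proof (rule nn_integral_mono_AE, use ae in eventually_elim)
    case (elim z)
    show ?case
    proof (cases "fst z = snd z")
      case True
      then show ?thesis by (simp add: ext0)
    next
      case False
      then show ?thesis using lnR[of "fst z" "snd z"] elim by (simp add: ext ennreal_leI)
    qed
  qed
  then have "?p \<le> ennreal R" by (simp add: P.emeasure_space_1)
  then have pfin: "?p < \<top>" using le_less_trans by fastforce
  have "enn2ereal ?p - enn2ereal ?n = ereal R - enn2ereal ?k"
  proof (cases "?n = \<top>")
    case True
    then have "?k = \<top>" using eq pfin by (auto simp: ennreal_add_eq_top)
    moreover have "enn2ereal ?p \<noteq> \<infinity>" using pfin by (metis enn2ereal_top enn2ereal_inject less_irrefl)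
    ultimately show ?thesis using True by (cases "enn2ereal ?p") auto
  next
    case False
    then have "?k + ?p \<noteq> \<top>" unfolding eq by (auto simp: ennreal_add_eq_top)
    then have kfin: "?k < \<top>" by (auto simp: ennreal_add_eq_top less_top)
    obtain p where p: "?p = ennreal p" "0 \<le> p" using pfin by (cases ?p rule: ennreal_cases) auto
    obtain n where n: "?n = ennreal n" "0 \<le> n" using False by (cases ?n rule: ennreal_cases) auto
    obtain k where k': "?k = ennreal k" "0 \<le> k" using kfin by (cases ?k rule: ennreal_cases) auto
    have "k + p = R + n"
      using eq p n k' R(1) by (simp flip: ennreal_plus)
    then show ?thesis using p n k' by (simp add: enn2ereal_ennreal)
  qed
  then show ?thesis
    by (simp add: ext_integral_def k split_beta)
qed

text \<open>For probability measures on one bounded interval both shifts only add constants.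
  Minimising the extended real energy there thus becomes minimising an energy with values in
  [0, infinity].\<close>

lemma log_energy_eq_weighted_energy:
  assumes n: "real_distribution \<nu>" and K: "AE x in \<nu>. x \<in> {l..u}"
    and R: "0 \<le> R" "u - l \<le> exp R"
    and V: "continuous_on UNIV V" and m: "\<And>x. x \<in> {l..u} \<Longrightarrow> \<bar>V x\<bar> \<le> m"
  shows "(\<integral>\<^sup>+x. ennreal (V x + m) \<partial>\<nu>) = ennreal (integral\<^sup>L \<nu> V + m)" "0 \<le> integral\<^sup>L \<nu> V + m"
    and "log_energy V \<nu> = enn2ereal (weighted_energy (\<lambda>x. ennreal (V x + m)) (log_kernel R) \<nu>) - ereal (m + R)"
proof -
  interpret real_distribution \<nu> by fact
  have [measurable]: "V \<in> borel_measurable borel" by (rule borel_measurable_continuous_onI[OF V])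
  have int: "integrable \<nu> V"
  proof (rule integrable_const_bound)
    show "AE x in \<nu>. norm (V x) \<le> m" using K by eventually_elim (use m in auto)
  qed measurable
  have pos: "AE x in \<nu>. 0 \<le> V x + m" using K by eventually_elim (use m in force)
  have "(\<integral>\<^sup>+x. ennreal (V x + m) \<partial>\<nu>) = ennreal (\<integral>x. V x + m \<partial>\<nu>)"
    by (rule nn_integral_eq_integral) (use int pos in auto)
  also have intm: "(\<integral>x. V x + m \<partial>\<nu>) = integral\<^sup>L \<nu> V + m"
    using int prob_space by (subst Bochner_Integration.integral_add) auto
  finally show v: "(\<integral>\<^sup>+x. ennreal (V x + m) \<partial>\<nu>) = ennreal (integral\<^sup>L \<nu> V + m)" .
  show nonneg: "0 \<le> integral\<^sup>L \<nu> V + m"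
    unfolding intm[symmetric] by (rule integral_nonneg_AE) (use pos in auto)
  let ?k = "\<integral>\<^sup>+x. \<integral>\<^sup>+y. log_kernel R x y \<partial>\<nu> \<partial>\<nu>"
  have "log_energy V \<nu> = ereal (integral\<^sup>L \<nu> V) - (ereal R - enn2ereal ?k)"
    unfolding log_energy_def ext_integral_eq_integral[OF int] ext_integral_ext_ln[OF n K R] by (rule refl)
  also have "\<dots> = enn2ereal (ennreal (integral\<^sup>L \<nu> V + m) + ?k) - ereal (m + R)"
  proof (cases ?k rule: ennreal_cases)
    case (real k)
    then show ?thesis
      using nonneg by (simp add: enn2ereal_ennreal flip: ennreal_plus)
  qed simp
  finally show "log_energy V \<nu> = enn2ereal (weighted_energy (\<lambda>x. ennreal (V x + m)) (log_kernel R) \<nu>) - ereal (m + R)"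
    by (simp add: weighted_energy_def v)
qed

lemma ln_abs_circle_diff:
  fixes b :: real
  assumes "0 < c" "cos t \<noteq> cos p"
  shows "ln \<bar>(c * (2 * cos t) + b) - (c * (2 * cos p) + b)\<bar> = ln c + ln \<bar>2 * cos t - 2 * cos p\<bar>"
proof -
  have "(c * (2 * cos t) + b) - (c * (2 * cos p) + b) = c * (2 * cos t - 2 * cos p)"
    by (simp add: algebra_simps)
  then show ?thesis using assms ln_mult_pos[of c "\<bar>2 * cos t - 2 * cos p\<bar>"] by (simp only: abs_mult) simp
qed

lemma circle_in_interval:
  fixes b :: real
  assumes "0 < c"
  shows "c * (2 * cos t) + b \<in> {- 2 * c + b..2 * c + b}"
proof -
  have "c * cos t \<le> c * 1" "c * (- 1) \<le> c * cos t" using assms by (intro mult_left_mono; simp)+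
  then show ?thesis by auto
qed

text \<open>For c > 0 the inverse of t -> 2 c cos t + b on its interval; clamping to [-1, 1] makes
  it continuous on the whole line.\<close>

definition circle_angle :: "real \<Rightarrow> real \<Rightarrow> real \<Rightarrow> real" where
  "circle_angle b c y = arccos (max (- 1) (min 1 ((y - b) / (2 * c))))"

lemma circle_angle_measurable [measurable]: "circle_angle b c \<in> borel_measurable borel"
proof (cases "c = 0")
  case False
  have "continuous_on UNIV (circle_angle b c)"
    unfolding circle_angle_def
    by (rule continuous_on_compose2[OF continuous_on_arccos'])
       (use False in \<open>auto intro!: continuous_intros\<close>)
  then show ?thesis by (rule borel_measurable_continuous_onI)
qed (simp add: circle_angle_def[abs_def])

lemma circle_angle_bounds: "circle_angle b c y \<in> {0..pi}"
  by (auto simp: circle_angle_def intro!: arccos_lbound arccos_ubound)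

lemma cos_circle_angle:
  fixes b :: real
  assumes "0 < c" "y \<in> {- 2 * c + b..2 * c + b}"
  shows "c * (2 * cos (circle_angle b c y)) + b = y"
proof -
  have "- 1 \<le> (y - b) / (2 * c)" "(y - b) / (2 * c) \<le> 1"
    using assms by (auto simp: field_simps)
  then have "cos (circle_angle b c y) = (y - b) / (2 * c)" by (simp add: circle_angle_def cos_arccos)
  then show ?thesis using assms by (simp add: field_simps)
qed

text \<open>Rescaling by c adds the constant ln c to the logarithm, which only the mean n = 0 can
  see.\<close>

lemma integral_angle_log:
  fixes b :: real
  assumes "0 < c"
  shows "integrable angle_measure (\<lambda>t. (R - ln \<bar>(c * (2 * cos t) + b) - (c * (2 * cos p) + b)\<bar>))"
    and "(\<integral>t. (R - ln \<bar>(c * (2 * cos t) + b) - (c * (2 * cos p) + b)\<bar>) * cos (real n * t) \<partial>angle_measure) =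
      (if n = 0 then R - ln c else cos (real n * p) / real n)"
proof -
  interpret prob_space angle_measure by (rule prob_space_angle_measure)
  let ?f = "\<lambda>t. (R - ln \<bar>(c * (2 * cos t) + b) - (c * (2 * cos p) + b)\<bar>)"
  let ?g = "\<lambda>t. (R - ln c) - ln \<bar>2 * cos t - 2 * cos p\<bar>"
  have ae: "AE t in angle_measure. ?g t = ?f t"
    using AE_angle_measure_cos_neq[of "cos p"]
    by eventually_elim (use ln_abs_circle_diff[OF assms] in simp)
  have ig: "integrable angle_measure ?g"
    by (intro Bochner_Integration.integrable_diff integrable_log_cos) auto
  show "integrable angle_measure ?f"
    by (rule integrable_cong_AE_imp[OF ig _ ae]) measurable
  have cosn: "(\<integral>t. cos (real n * t) \<partial>angle_measure) = (if n = 0 then 1 else 0)"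
    using integral_cos_multiple[of "int n"]
    by (subst integral_angle_measure(2)) (auto intro!: continuous_intros)
  have i1: "integrable angle_measure (\<lambda>t. cos (real n * t))"
    by (rule integrable_const_bound[of _ 1]) auto
  have i2: "integrable angle_measure (\<lambda>t. ln \<bar>2 * cos t - 2 * cos p\<bar> * cos (real n * t))"
  proof (rule Bochner_Integration.integrable_bound[OF integrable_log_cos[of p]])
    show "AE t in angle_measure. norm (ln \<bar>2 * cos t - 2 * cos p\<bar> * cos (real n * t)) \<le> norm (ln \<bar>2 * cos t - 2 * cos p\<bar>)"
      by (intro AE_I2) (auto simp: abs_mult intro: mult_left_le)
  qed measurable
  have "(\<integral>t. ?f t * cos (real n * t) \<partial>angle_measure) = (\<integral>t. ?g t * cos (real n * t) \<partial>angle_measure)"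
    by (rule integral_cong_AE) (use ae in \<open>auto elim: eventually_mono\<close>)
  also have "\<dots> = (\<integral>t. (R - ln c) * cos (real n * t) - ln \<bar>2 * cos t - 2 * cos p\<bar> * cos (real n * t) \<partial>angle_measure)"
    by (simp only: left_diff_distrib)
  also have "\<dots> = (R - ln c) * (\<integral>t. cos (real n * t) \<partial>angle_measure) -
      (\<integral>t. ln \<bar>2 * cos t - 2 * cos p\<bar> * cos (real n * t) \<partial>angle_measure)"
    using i1 i2 by (subst Bochner_Integration.integral_diff) auto
  finally show "(\<integral>t. ?f t * cos (real n * t) \<partial>angle_measure) =
      (if n = 0 then R - ln c else cos (real n * p) / real n)"
    unfolding cosn integral_log_cos by simp
qed

text \<open>The logarithmic potential of the arcsine law is the constant ln c throughout its
  interval: the case n = 0 of the moments. The two forms differ only where the angle hits y, a null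
  set.\<close>

lemma nn_integral_angle_log_kernel:
  fixes b :: real
  assumes "0 < c" and R: "4 * c \<le> exp R" and y: "y \<in> {- 2 * c + b..2 * c + b}"
  shows "(\<integral>\<^sup>+t. log_kernel R (c * (2 * cos t) + b) y \<partial>angle_measure) = ennreal (R - ln c)"
    and "(\<integral>\<^sup>+t. ennreal (R - ln \<bar>(c * (2 * cos t) + b) - y\<bar>) \<partial>angle_measure) = ennreal (R - ln c)"
proof -
  define p where "p = circle_angle b c y"
  have y_eq: "y = c * (2 * cos p) + b"
    unfolding p_def using cos_circle_angle[OF assms(1) y] by simp
  have ae: "AE t in angle_measure. c * (2 * cos t) + b \<noteq> y"
    using AE_angle_measure_cos_neq[of "cos p"]
    by eventually_elim (use assms(1) y_eq in auto)
  have pos: "AE t in angle_measure. 0 \<le> R - ln \<bar>(c * (2 * cos t) + b) - y\<bar>"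
    using ae
  proof eventually_elim
    case (elim t)
    have "\<bar>(c * (2 * cos t) + b) - y\<bar> \<le> exp R"
      using circle_in_interval[OF assms(1), of t b] y R by auto
    then have "ln \<bar>(c * (2 * cos t) + b) - y\<bar> \<le> ln (exp R)"
      using elim by (intro ln_mono) auto
    then show ?case by simp
  qed
  have "(\<integral>\<^sup>+t. ennreal (R - ln \<bar>(c * (2 * cos t) + b) - y\<bar>) \<partial>angle_measure) =
      ennreal (\<integral>t. R - ln \<bar>(c * (2 * cos t) + b) - y\<bar> \<partial>angle_measure)"
    by (rule nn_integral_eq_integral) (use integral_angle_log(1)[OF assms(1)] pos in \<open>auto simp: y_eq\<close>)
  then show *: "(\<integral>\<^sup>+t. ennreal (R - ln \<bar>(c * (2 * cos t) + b) - y\<bar>) \<partial>angle_measure) = ennreal (R - ln c)"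
    using integral_angle_log(2)[OF assms(1), of R b p 0] by (simp add: y_eq)
  have "(\<integral>\<^sup>+t. log_kernel R (c * (2 * cos t) + b) y \<partial>angle_measure) =
      (\<integral>\<^sup>+t. ennreal (R - ln \<bar>(c * (2 * cos t) + b) - y\<bar>) \<partial>angle_measure)"
    by (rule nn_integral_cong_AE) (use ae in \<open>auto elim!: eventually_mono simp: log_kernel_def\<close>)
  then show "(\<integral>\<^sup>+t. log_kernel R (c * (2 * cos t) + b) y \<partial>angle_measure) = ennreal (R - ln c)"
    using * by simp
qed

text \<open>Taking an image of the angle law keeps the endpoint singularities of the arcsine density
  out of the energy computations.\<close>

definition arcsine_measure :: "real \<Rightarrow> real \<Rightarrow> real measure" where
  "arcsine_measure b c = distr angle_measure borel (\<lambda>t. c * (2 * cos t) + b)"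

lemma real_distribution_arcsine: "real_distribution (arcsine_measure b c)"
  unfolding arcsine_measure_def real_distribution_def real_distribution_axioms_def
  by (auto intro!: prob_space.prob_space_distr prob_space_angle_measure)

lemma AE_arcsine_measure:
  assumes "0 < c"
  shows "AE x in arcsine_measure b c. x \<in> {- 2 * c + b..2 * c + b}"
  unfolding arcsine_measure_def using circle_in_interval[OF assms, of _ b]
  by (subst AE_distr_iff) auto

text \<open>The inner integral is the constant potential. Finiteness admits the arcsine law as a
  competitor and bounds the minimal energy.\<close>

lemma arcsine_kernel_energy:
  assumes "0 < c" "4 * c \<le> exp R"
  shows "(\<integral>\<^sup>+x. \<integral>\<^sup>+y. log_kernel R x y \<partial>arcsine_measure b c \<partial>arcsine_measure b c) = ennreal (R - ln c)"
proof -
  interpret A: real_distribution "arcsine_measure b c" by (rule real_distribution_arcsine)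
  interpret prob_space angle_measure by (rule prob_space_angle_measure)
  have inner: "(\<integral>\<^sup>+y. log_kernel R x y \<partial>arcsine_measure b c) = ennreal (R - ln c)"
    if "x \<in> {- 2 * c + b..2 * c + b}" for x
    using nn_integral_angle_log_kernel(1)[OF assms that]
    unfolding arcsine_measure_def by (subst nn_integral_distr) (auto simp: log_kernel_commute[of R x])
  have "(\<integral>\<^sup>+x. \<integral>\<^sup>+y. log_kernel R x y \<partial>arcsine_measure b c \<partial>arcsine_measure b c) =
      (\<integral>\<^sup>+x. ennreal (R - ln c) \<partial>arcsine_measure b c)"
    by (intro nn_integral_cong_AE eventually_mono[OF AE_arcsine_measure[OF assms(1), of b]] inner)
  then show ?thesis by (simp add: A.emeasure_space_1[simplified])
qed

section \<open>Euler-Lagrange equality and the cosine moments of the equilibrium measure\<close>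

section \<open>Equilibrium measures\<close>

text \<open>An upper bound everywhere on the support and a lower bound for the arcsine mean force
  equality at almost every angle. \<open>\<kappa>\<close> is the kernel energy of
  \<open>\<mu>\<close>, counted twice in the constant of the equality but once in
  \<open>I_min V\<close>.\<close>

lemma equilibrium_euler_lagrange:
  fixes V :: "real \<Rightarrow> real" and b c :: real
  assumes V: "continuous_on UNIV V" and eq: "equilibrium_measure V \<mu>" and c: "0 < c"
    and supp: "measure_support \<mu> = {- 2 * c + b..2 * c + b}"
  defines "R \<equiv> ln (4 * c + 1)"
  obtains m \<kappa> where "0 \<le> \<kappa>" "0 \<le> integral\<^sup>L \<mu> V + m" "\<And>t. 0 \<le> V (c * (2 * cos t) + b) + m"
    "I_min V = ereal (integral\<^sup>L \<mu> V + \<kappa> - R)"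
    "AE t in angle_measure. ennreal (V (c * (2 * cos t) + b) + m) +
       2 * (\<integral>\<^sup>+y. log_kernel R (c * (2 * cos t) + b) y \<partial>\<mu>) = ennreal (integral\<^sup>L \<mu> V + m + 2 * \<kappa>)"
proof -
  let ?K = "{- 2 * c + b..2 * c + b}"
  have [measurable]: "V \<in> borel_measurable borel" by (rule borel_measurable_continuous_onI[OF V])
  have mu: "real_distribution \<mu>" and Imin: "log_energy V \<mu> = I_min V"
    using eq by (auto simp: equilibrium_measure_def)
  have K: "AE x in \<mu>. x \<in> ?K" using AE_measure_support[OF mu] supp by simp
  \<comment> \<open>The interval has length 4 c, so exp R must be at least 4 c; the added 1 makes R
    nonnegative as well.\<close>
  have R: "0 \<le> R" "4 * c \<le> exp R" "2 * c + b - (- 2 * c + b) \<le> exp R"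
    using c by (auto simp: R_def)
  have "compact (V ` ?K)"
    by (intro compact_continuous_image continuous_on_subset[OF V]) auto
  then obtain m where m: "\<And>x. x \<in> ?K \<Longrightarrow> \<bar>V x\<bar> \<le> m"
    by (metis compact_imp_bounded bounded_real imageI)
  let ?v = "\<lambda>x. ennreal (V x + m)"
  note energy = log_energy_eq_weighted_energy[OF _ _ R(1,3) V m]
  have v_integral: "(\<integral>\<^sup>+x. ?v x \<partial>\<rho>) = ennreal (integral\<^sup>L \<rho> V + m)"
    if "real_distribution \<rho>" "AE x in \<rho>. x \<in> ?K" for \<rho>
    using that by (rule energy(1))
  interpret energy_kernel ?v "log_kernel R" ?K
    by unfold_locales (auto simp: log_kernel_commute)
  let ?E = "weighted_energy ?v (log_kernel R)"
  \<comment> \<open>For distributions carried by the interval, \<open>log_energy\<close> is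
    \<open>?E\<close> less the finite constant m + R, which cancels.\<close>
  have min: "?E \<mu> \<le> ?E \<rho>" if r: "real_distribution \<rho>" "AE x in \<rho>. x \<in> ?K" for \<rho>
  proof -
    have "log_energy V \<mu> \<le> log_energy V \<rho>"
      unfolding Imin I_min_def using r by (intro INF_lower) auto
    then have "enn2ereal (?E \<mu>) - ereal (m + R) \<le> enn2ereal (?E \<rho>) - ereal (m + R)"
      using energy(3)[OF mu K] energy(3)[OF r] by simp
    then have "enn2ereal (?E \<mu>) \<le> enn2ereal (?E \<rho>)"
      by (cases "enn2ereal (?E \<mu>)"; cases "enn2ereal (?E \<rho>)") auto
    then show ?thesis by (simp add: less_eq_ennreal.rep_eq)
  qed
  let ?\<alpha> = "arcsine_measure b c"
  note arc = real_distribution_arcsine[of b c] AE_arcsine_measure[OF c, of b]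
  have arcfin: "(\<integral>\<^sup>+x. \<integral>\<^sup>+y. log_kernel R x y \<partial>?\<alpha> \<partial>?\<alpha>) < \<infinity>"
    by (simp add: arcsine_kernel_energy[OF c R(2)])
  have "?E ?\<alpha> < \<infinity>"
    using arcfin v_integral[OF arc] by (simp add: weighted_energy_def)
  then have fin: "?E \<mu> < \<infinity>" using min[OF arc] by (rule le_less_trans[rotated])
  then have "(\<integral>\<^sup>+x. \<integral>\<^sup>+y. log_kernel R x y \<partial>\<mu> \<partial>\<mu>) \<noteq> \<top>"
    by (auto simp: weighted_energy_def)
  then obtain \<kappa> where kappa: "(\<integral>\<^sup>+x. \<integral>\<^sup>+y. log_kernel R x y \<partial>\<mu> \<partial>\<mu>) = ennreal \<kappa>" "0 \<le> \<kappa>"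
    by (cases "\<integral>\<^sup>+x. \<integral>\<^sup>+y. log_kernel R x y \<partial>\<mu> \<partial>\<mu>" rule: ennreal_cases) auto
  let ?\<Phi> = "weighted_potential ?v (log_kernel R) \<mu>"
  define C where "C = (\<integral>\<^sup>+x. ?\<Phi> x \<partial>\<mu>)"
  have nn: "0 \<le> integral\<^sup>L \<mu> V + m" by (rule energy(2)[OF mu K])
  have C: "C = ennreal (integral\<^sup>L \<mu> V + m + 2 * \<kappa>)"
    unfolding C_def nn_integral_weighted_potential[OF mu mu] v_integral[OF mu K] kappa(1)
    using kappa(2) nn by (simp add: ennreal_mult)
  have le: "?\<Phi> x \<le> C" if "x \<in> ?K" for x
    unfolding C_def
  proof (rule minimizer_weighted_potential_support_le[OF mu K min fin])
    show "x \<in> measure_support \<mu>" using that supp by simp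
    fix x X y assume X: "X \<longlonglongrightarrow> (x::real)"
    have "isCont V x" using V by (simp add: continuous_on_eq_continuous_at)
    then have "(\<lambda>n. V (X n)) \<longlonglongrightarrow> V x" using X by (rule isCont_tendsto_compose)
    then show "(\<lambda>n. ?v (X n) + 2 * log_kernel R (X n) y) \<longlonglongrightarrow> ?v x + 2 * log_kernel R x y"
      by (intro tendsto_intros ennreal_tendsto_cmult log_kernel_tendsto X) auto
  qed
  have ge: "C \<le> (\<integral>\<^sup>+x. ?\<Phi> x \<partial>?\<alpha>)"
    unfolding C_def by (rule minimizer_weighted_potential_le[OF mu arc(1) K arc(2) min fin arcfin])
  interpret A: real_distribution ?\<alpha> by (rule arc)
  note [measurable] = potential_measurable(2)[OF mu]
  have leAE: "AE x in ?\<alpha>. ?\<Phi> x \<le> C" using arc(2) by eventually_elim (rule le)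
  \<comment> \<open>If the potential were below C on a set of positive arcsine mass, the upper bound
    would push its arcsine mean strictly below C, against \<open>ge\<close>.\<close>
  have "AE x in ?\<alpha>. C \<le> ?\<Phi> x"
  proof (rule ccontr)
    assume "\<not> ?thesis"
    moreover have "(\<integral>\<^sup>+x. C \<partial>?\<alpha>) = C" by (simp add: A.emeasure_space_1[simplified])
    moreover have "(\<integral>\<^sup>+x. ?\<Phi> x \<partial>?\<alpha>) \<le> (\<integral>\<^sup>+x. C \<partial>?\<alpha>)" by (rule nn_integral_mono_AE[OF leAE])
    moreover have "C < \<top>" by (simp add: C)
    ultimately have "(\<integral>\<^sup>+x. ?\<Phi> x \<partial>?\<alpha>) < (\<integral>\<^sup>+x. C \<partial>?\<alpha>)"
      using leAE by (intro nn_integral_less) auto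
    then show False using ge \<open>(\<integral>\<^sup>+x. C \<partial>?\<alpha>) = C\<close> by simp
  qed
  with leAE have "AE x in ?\<alpha>. ?\<Phi> x = C" by eventually_elim (rule antisym)
  then have ae: "AE t in angle_measure. ?\<Phi> (c * (2 * cos t) + b) = C"
    unfolding arcsine_measure_def by (subst (asm) AE_distr_iff) auto
  have I: "I_min V = ereal (integral\<^sup>L \<mu> V + \<kappa> - R)"
    using energy(3)[OF mu K] kappa nn
    by (simp add: Imin weighted_energy_def v_integral[OF mu K] enn2ereal_ennreal flip: ennreal_plus)
  have nonneg: "0 \<le> V (c * (2 * cos t) + b) + m" for t
    using m[OF circle_in_interval[OF c, of t]] by (simp add: abs_le_iff)
  show ?thesis
    by (rule that[OF kappa(2) nn nonneg I ae[unfolded weighted_potential_eq[OF mu] C]])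
qed

text \<open>Fubini moves the cosine test onto the kernel, whose moments are known, leaving cosines
  of the angle of y. The equation for n = 0 expresses \<open>\<kappa>\<close> through R, ln c, A_0
  and the integral of V; substituting it removes both \<open>\<kappa>\<close> and R from the minimal
  energy.\<close>

lemma equilibrium_cosine_moments:
  fixes V :: "real \<Rightarrow> real" and b c :: real
  assumes V: "continuous_on UNIV V" and eq: "equilibrium_measure V \<mu>" and c: "0 < c"
    and supp: "measure_support \<mu> = {- 2 * c + b..2 * c + b}"
  defines "A \<equiv> cosine_coeff (\<lambda>t. V (c * (2 * cos t) + b))"
  shows "(\<integral>y. cos (real (Suc n) * circle_angle b c y) \<partial>\<mu>) = - (real (Suc n) / 2) * A (Suc n)"
    and "I_min V = ereal ((A 0 + integral\<^sup>L \<mu> V) / 2 - ln c)"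
proof -
  define R where "R = ln (4 * c + 1)"
  let ?x = "\<lambda>t. c * (2 * cos t) + b"
  let ?\<phi> = "\<lambda>y. circle_angle b c y"
  let ?K = "{- 2 * c + b..2 * c + b}"
  have [measurable]: "V \<in> borel_measurable borel" by (rule borel_measurable_continuous_onI[OF V])
  have R: "0 \<le> R" "4 * c \<le> exp R" using c by (auto simp: R_def)
  have mu: "real_distribution \<mu>" using eq by (auto simp: equilibrium_measure_def)
  interpret m: real_distribution \<mu> by fact
  interpret a: prob_space angle_measure by (rule prob_space_angle_measure)
  interpret P: pair_sigma_finite angle_measure \<mu> by unfold_locales
  have K: "AE x in \<mu>. x \<in> ?K" using AE_measure_support[OF mu] supp by simp
  obtain m \<kappa> where el: "0 \<le> \<kappa>" "0 \<le> integral\<^sup>L \<mu> V + m" "\<And>t. 0 \<le> V (?x t) + m"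
    "I_min V = ereal (integral\<^sup>L \<mu> V + \<kappa> - R)"
    "AE t in angle_measure. ennreal (V (?x t) + m) + 2 * (\<integral>\<^sup>+y. log_kernel R (?x t) y \<partial>\<mu>) =
       ennreal (integral\<^sup>L \<mu> V + m + 2 * \<kappa>)"
    by (rule equilibrium_euler_lagrange[OF V eq c supp, folded R_def]) (rule that; assumption)
  \<comment> \<open>Real-valued kernel, as needed against signed test functions. On the diagonal it
    takes the harmless value R, since \<open>ln 0 = 0\<close>.\<close>
  define k where "k = (\<lambda>t y. R - ln \<bar>?x t - y\<bar>)"
  have km [measurable]: "(\<lambda>(t, y). k t y) \<in> borel_measurable (borel \<Otimes>\<^sub>M borel)"
    unfolding k_def by measurable
  have kpos: "0 \<le> k t y" if "y \<in> ?K" for t y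
  proof (cases "?x t = y")
    case False
    have "\<bar>?x t - y\<bar> \<le> exp R"
      using circle_in_interval[OF c, of t b] that R by auto
    then have "ln \<bar>?x t - y\<bar> \<le> ln (exp R)"
      using False by (intro ln_mono) auto
    then show ?thesis by (simp add: k_def)
  qed (simp add: k_def R)
  have kposAE: "AE y in \<mu>. 0 \<le> k t y" for t
    using K by eventually_elim (rule kpos)
  \<comment> \<open>By Tonelli the integral over t may be taken first; it is the constant arcsine
    potential, so the total is finite.\<close>
  have kint: "integrable (angle_measure \<Otimes>\<^sub>M \<mu>) (\<lambda>(t, y). k t y)"
  proof (rule integrableI_bounded)
    have "(\<integral>\<^sup>+z. ennreal (norm (case z of (t, y) \<Rightarrow> k t y)) \<partial>(angle_measure \<Otimes>\<^sub>M \<mu>)) =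
        (\<integral>\<^sup>+y. \<integral>\<^sup>+t. ennreal (norm (k t y)) \<partial>angle_measure \<partial>\<mu>)"
      by (subst P.nn_integral_snd[symmetric]) auto
    also have "\<dots> = (\<integral>\<^sup>+y. ennreal (R - ln c) \<partial>\<mu>)"
    proof (rule nn_integral_cong_AE, use K in eventually_elim)
      case (elim y)
      then have "(\<integral>\<^sup>+t. ennreal (norm (k t y)) \<partial>angle_measure) = (\<integral>\<^sup>+t. ennreal (R - ln \<bar>?x t - y\<bar>) \<partial>angle_measure)"
        using kpos[OF elim] by (intro nn_integral_cong) (simp add: k_def)
      then show ?case using nn_integral_angle_log_kernel(2)[OF c R(2) elim] by simp
    qed
    also have "\<dots> < \<infinity>" by (simp add: m.emeasure_space_1[simplified])
    finally show "(\<integral>\<^sup>+z. ennreal (norm (case z of (t, y) \<Rightarrow> k t y)) \<partial>(angle_measure \<Otimes>\<^sub>M \<mu>)) < \<infinity>" .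
  qed measurable
  have kcint: "integrable (angle_measure \<Otimes>\<^sub>M \<mu>) (\<lambda>(t, y). k t y * cos (real n * t))" for n
  proof (rule Bochner_Integration.integrable_bound[OF kint])
    show "AE z in angle_measure \<Otimes>\<^sub>M \<mu>. norm (case z of (t, y) \<Rightarrow> k t y * cos (real n * t)) \<le> norm (case z of (t, y) \<Rightarrow> k t y)"
      by (intro AE_I2) (auto simp: abs_mult intro!: mult_left_le)
  qed measurable
  define U where "U = (\<lambda>t. \<integral>y. k t y \<partial>\<mu>)"
  define l where "l = integral\<^sup>L \<mu> V + 2 * \<kappa>"
  have el': "AE t in angle_measure. V (?x t) + 2 * U t = l"
    using el(5) P.AE_integrable_fst[OF kint]
  proof eventually_elim
    case (elim t)
    \<comment> \<open>A finite potential at this point means that \<open>\<mu>\<close> has no atom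
      there, so the infinite diagonal value may be replaced by that of \<open>k\<close>.\<close>
    then have "(\<integral>\<^sup>+y. log_kernel R (?x t) y \<partial>\<mu>) \<noteq> \<infinity>"
      by (auto simp: ennreal_mult_eq_top_iff)
    then have "AE y in \<mu>. log_kernel R (?x t) y \<noteq> \<infinity>"
      by (intro nn_integral_PInf_AE) auto
    then have "(\<integral>\<^sup>+y. log_kernel R (?x t) y \<partial>\<mu>) = (\<integral>\<^sup>+y. ennreal (k t y) \<partial>\<mu>)"
      by (intro nn_integral_cong_AE) (auto elim!: eventually_mono simp: log_kernel_def k_def split: if_splits)
    also have "\<dots> = ennreal (U t)"
      unfolding U_def by (rule nn_integral_eq_integral[OF elim(2)]) (rule kposAE)
    finally have "ennreal (V (?x t) + m) + 2 * ennreal (U t) = ennreal (integral\<^sup>L \<mu> V + m + 2 * \<kappa>)"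
      using elim(1) by simp
    moreover have "0 \<le> U t"
      unfolding U_def by (rule integral_nonneg_AE) (rule kposAE)
    ultimately have "ennreal (V (?x t) + m + 2 * U t) = ennreal (integral\<^sup>L \<mu> V + m + 2 * \<kappa>)"
      using el(3)[of t] by (simp add: ennreal_mult)
    then show ?case
      using el(1,2) el(3)[of t] \<open>0 \<le> U t\<close> by (subst (asm) ennreal_inj) (auto simp: l_def)
  qed
  have Ucos: "integrable angle_measure (\<lambda>t. U t * cos (real n * t))"
    "(\<integral>t. U t * cos (real n * t) \<partial>angle_measure) =
      (\<integral>y. (if n = 0 then R - ln c else cos (real n * ?\<phi> y) / real n) \<partial>\<mu>)" for n
  proof -
    have U: "U t * cos (real n * t) = (\<integral>y. k t y * cos (real n * t) \<partial>\<mu>)" for t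
      unfolding U_def by simp
    show "integrable angle_measure (\<lambda>t. U t * cos (real n * t))"
      unfolding U using P.integrable_fst[OF kcint[of n]] by simp
    have "(\<integral>t. U t * cos (real n * t) \<partial>angle_measure) = (\<integral>y. \<integral>t. k t y * cos (real n * t) \<partial>angle_measure \<partial>\<mu>)"
      unfolding U by (rule P.Fubini_integral[OF kcint[of n], symmetric])
    also have "\<dots> = (\<integral>y. (if n = 0 then R - ln c else cos (real n * ?\<phi> y) / real n) \<partial>\<mu>)"
    proof (rule integral_cong_AE)
      show "AE y in \<mu>. (\<integral>t. k t y * cos (real n * t) \<partial>angle_measure) =
          (if n = 0 then R - ln c else cos (real n * ?\<phi> y) / real n)"
        using K
      proof eventually_elim
        case (elim y)
        show ?case
          using integral_angle_log(2)[OF c, of R b "?\<phi> y" n]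
          unfolding k_def cos_circle_angle[OF c elim] .
      qed
    qed measurable
    finally show "(\<integral>t. U t * cos (real n * t) \<partial>angle_measure) =
      (\<integral>y. (if n = 0 then R - ln c else cos (real n * ?\<phi> y) / real n) \<partial>\<mu>)" .
  qed
  have Vc: "continuous_on {0..pi} (\<lambda>t. V (?x t))"
    by (intro continuous_intros continuous_on_compose2[OF V]) auto
  have main: "A n + 2 * (\<integral>t. U t * cos (real n * t) \<partial>angle_measure) = (if n = 0 then l else 0)" for n
  proof -
    have i1: "integrable angle_measure (\<lambda>t. V (?x t) * cos (real n * t))"
      by (rule integral_angle_measure) (auto intro!: continuous_intros Vc)
    have "(\<integral>t. V (?x t) * cos (real n * t) + 2 * (U t * cos (real n * t)) \<partial>angle_measure) =
        (\<integral>t. l * cos (real n * t) \<partial>angle_measure)"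
    proof (rule integral_cong_AE)
      show "AE t in angle_measure. V (?x t) * cos (real n * t) + 2 * (U t * cos (real n * t)) = l * cos (real n * t)"
        using el' by eventually_elim (simp flip: distrib_right mult.assoc)
      show "(\<lambda>t. V (?x t) * cos (real n * t) + 2 * (U t * cos (real n * t))) \<in> borel_measurable angle_measure"
        using borel_measurable_integrable[OF Ucos(1)[of n]] by measurable
    qed measurable
    moreover have "(\<integral>t. l * cos (real n * t) \<partial>angle_measure) = (if n = 0 then l else 0)"
      using integral_cos_multiple[of "int n"]
      by (subst integral_angle_measure(2)) (auto intro!: continuous_intros)
    moreover have "A n = (\<integral>t. V (?x t) * cos (real n * t) \<partial>angle_measure)"
      unfolding A_def by (rule cosine_coeff_eq_expectation[OF Vc]) measurable
    moreover have "(\<integral>t. V (?x t) * cos (real n * t) + 2 * (U t * cos (real n * t)) \<partial>angle_measure) =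
       (\<integral>t. V (?x t) * cos (real n * t) \<partial>angle_measure) + 2 * (\<integral>t. U t * cos (real n * t) \<partial>angle_measure)"
      using i1 Ucos(1)[of n] by (subst Bochner_Integration.integral_add) auto
    ultimately show ?thesis by simp
  qed
  have "A 0 + 2 * (R - ln c) = l"
    using main[of 0] Ucos(2)[of 0] m.prob_space by simp
  then show "I_min V = ereal ((A 0 + integral\<^sup>L \<mu> V) / 2 - ln c)"
    unfolding el(4) l_def by (simp add: field_simps)
  have "A (Suc n) + 2 * ((\<integral>y. cos (real (Suc n) * ?\<phi> y) \<partial>\<mu>) / real (Suc n)) = 0"
    using main[of "Suc n"] Ucos(2)[of "Suc n"] by (simp del: of_nat_Suc)
  then show "(\<integral>y. cos (real (Suc n) * ?\<phi> y) \<partial>\<mu>) = - (real (Suc n) / 2) * A (Suc n)"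
    by (simp add: field_simps del: of_nat_Suc)
qed

text \<open>The uniformly convergent cosine series of V is integrated against \<open>\<mu>\<close>:
  each coefficient 2 A_n meets the moment - n A_n / 2, which gives - n A_n^2.\<close>

lemma equilibrium_integral_sums:
  fixes V :: "real \<Rightarrow> real" and b c :: real
  assumes V: "continuous_on UNIV V" and eq: "equilibrium_measure V \<mu>" and c: "0 < c"
    and supp: "measure_support \<mu> = {- 2 * c + b..2 * c + b}"
  defines "A \<equiv> cosine_coeff (\<lambda>t. V (c * (2 * cos t) + b))"
  assumes sm: "summable (\<lambda>n. \<bar>A (Suc n)\<bar>)"
  shows "(\<lambda>n. real (Suc n) * (A (Suc n))\<^sup>2) sums (A 0 - integral\<^sup>L \<mu> V)"
proof -
  let ?x = "\<lambda>t. c * (2 * cos t) + b"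
  let ?\<phi> = "\<lambda>y. circle_angle b c y"
  let ?K = "{- 2 * c + b..2 * c + b}"
  have mu: "real_distribution \<mu>" using eq by (auto simp: equilibrium_measure_def)
  interpret m: real_distribution \<mu> by fact
  have [measurable]: "V \<in> borel_measurable borel" by (rule borel_measurable_continuous_onI[OF V])
  have K: "AE x in \<mu>. x \<in> ?K" using AE_measure_support[OF mu] supp by simp
  let ?S = "\<lambda>N y. A 0 + 2 * (\<Sum>n<N. A (Suc n) * cos (real (Suc n) * ?\<phi> y))"
  have ul: "uniform_limit {0..pi} (\<lambda>N t. A 0 + 2 * (\<Sum>n<N. A (Suc n) * cos (real (Suc n) * t)))
      (\<lambda>t. V (?x t)) sequentially"
    unfolding A_def
    by (rule cosine_series_uniform_limit)
       (use sm in \<open>auto simp: A_def intro!: continuous_intros continuous_on_compose2[OF V]\<close>)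
  have i: "integrable \<mu> (\<lambda>y. cos (real n * ?\<phi> y))" for n
    by (rule m.integrable_const_bound[of _ 1]) auto
  have "(\<lambda>N. \<integral>y. ?S N y \<partial>\<mu>) \<longlonglongrightarrow> integral\<^sup>L \<mu> V"
  proof (rule integral_dominated_convergence)
    show "integrable \<mu> (\<lambda>_. \<bar>A 0\<bar> + 2 * (\<Sum>n. \<bar>A (Suc n)\<bar>))" by simp
    show "AE y in \<mu>. (\<lambda>N. ?S N y) \<longlonglongrightarrow> V y"
      using K
    proof eventually_elim
      case (elim y)
      from tendsto_uniform_limitI[OF ul circle_angle_bounds[of b c y]] show ?case
        unfolding cos_circle_angle[OF c elim] .
    qed
    fix N
    show "AE y in \<mu>. norm (?S N y) \<le> \<bar>A 0\<bar> + 2 * (\<Sum>n. \<bar>A (Suc n)\<bar>)"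
    proof (rule AE_I2)
      fix y
      have "\<bar>\<Sum>n<N. A (Suc n) * cos (real (Suc n) * ?\<phi> y)\<bar> \<le> (\<Sum>n<N. \<bar>A (Suc n)\<bar>)"
        by (rule order_trans[OF sum_abs]) (auto intro!: sum_mono simp: abs_mult intro: mult_left_le)
      also have "\<dots> \<le> (\<Sum>n. \<bar>A (Suc n)\<bar>)" by (rule sum_le_suminf[OF sm]) auto
      finally show "norm (?S N y) \<le> \<bar>A 0\<bar> + 2 * (\<Sum>n. \<bar>A (Suc n)\<bar>)" by simp
    qed
  qed measurable
  moreover have "(\<integral>y. ?S N y \<partial>\<mu>) = A 0 - (\<Sum>n<N. real (Suc n) * (A (Suc n))\<^sup>2)" for N
  proof -
    have "(\<integral>y. ?S N y \<partial>\<mu>) = A 0 + 2 * (\<Sum>n<N. A (Suc n) * (\<integral>y. cos (real (Suc n) * ?\<phi> y) \<partial>\<mu>))"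
      using i m.prob_space by (simp add: Bochner_Integration.integral_sum del: of_nat_Suc)
    also have "\<dots> = A 0 - (\<Sum>n<N. real (Suc n) * (A (Suc n))\<^sup>2)"
      unfolding equilibrium_cosine_moments(1)[OF V eq c supp, folded A_def]
      by (simp add: sum_distrib_left power2_eq_square mult_ac flip: sum_negf del: of_nat_Suc)
    finally show ?thesis .
  qed
  ultimately have "(\<lambda>N. A 0 - (\<Sum>n<N. real (Suc n) * (A (Suc n))\<^sup>2)) \<longlonglongrightarrow> integral\<^sup>L \<mu> V"
    by simp
  from tendsto_diff[OF tendsto_const[of "A 0"] this] show ?thesis
    by (simp add: sums_def)
qed

section \<open>The substitution x = 2 cos t and the final formula\<close>

section \<open>The arcsine weight\<close>

text \<open>Under x = 2 cos t the arcsine weight becomes the constant 1 / pi. The substitution rule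
  for signed functions asks for integrability first; that of the weight comes from the rule for
  nonnegative functions.\<close>

lemma integral_chebyshev_weight:
  assumes h: "continuous_on UNIV h"
  shows "(LBINT x:{-2..2}. h x / (pi * sqrt (4 - x\<^sup>2))) = integral {0..pi} (\<lambda>t. h (2 * cos t)) / pi"
proof -
  have [measurable]: "h \<in> borel_measurable borel" by (rule borel_measurable_continuous_onI[OF h])
  \<comment> \<open>The minus sign makes the substitution increasing, as the substitution rule
    expects; the reflection t -> pi - t undoes it at the end.\<close>
  let ?g = "\<lambda>t. - (2 * cos t) :: real" and ?g' = "\<lambda>t. 2 * sin t :: real"
  let ?w = "\<lambda>x. 1 / (pi * sqrt (4 - x\<^sup>2)) :: real"
  have ends: "?g 0 = -2" "?g pi = 2" by auto
  have deriv: "(?g has_real_derivative ?g' t) (at t)" for t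
    by (auto intro!: derivative_eq_intros)
  have cont: "continuous_on {0..pi} ?g'" by (intro continuous_intros)
  have pos: "0 \<le> ?g' t" if "t \<in> {0..pi}" for t using that by (simp add: sin_ge_zero)
  \<comment> \<open>At the endpoints the weight evaluates to 1 / 0 = 0, so the product is 1 / pi
    only on the open interval.\<close>
  have wg: "?w (?g t) * ?g' t = indicator {0<..<pi} t / pi" if "t \<in> {0..pi}" for t
  proof (cases "t \<in> {0<..<pi}")
    case True
    then have "0 < sin t" by (simp add: sin_gt_zero)
    have "4 - (?g t)\<^sup>2 = (2 * sin t)\<^sup>2"
      by (simp add: power_mult_distrib cos_squared_eq)
    then have "sqrt (4 - (?g t)\<^sup>2) = \<bar>2 * sin t\<bar>"
      by (simp only: real_sqrt_abs)
    then have "sqrt (4 - (?g t)\<^sup>2) = 2 * sin t"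
      using \<open>0 < sin t\<close> by simp
    then show ?thesis using True \<open>0 < sin t\<close> by simp
  next
    case False
    then have "t = 0 \<or> t = pi" using that by auto
    then show ?thesis using False by auto
  qed
  have wm: "set_borel_measurable borel {?g 0..?g pi} ?w"
    unfolding set_borel_measurable_def by measurable
  have "(\<integral>\<^sup>+x. ?w x * indicator {?g 0..?g pi} x \<partial>lborel) = (\<integral>\<^sup>+t. ?w (?g t) * ?g' t * indicator {0..pi} t \<partial>lborel)"
    by (rule nn_integral_substitution[OF wm deriv cont pos]) auto
  also have "\<dots> \<le> (\<integral>\<^sup>+t. ennreal (1 / pi) * indicator {0..pi} t \<partial>lborel)"
  proof (rule nn_integral_mono)
    fix t
    show "ennreal (?w (?g t) * ?g' t * indicator {0..pi} t) \<le> ennreal (1 / pi) * indicator {0..pi} t"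
    proof (cases "t \<in> {0..pi}")
      case True
      then show ?thesis unfolding wg[OF True] by (simp add: indicator_def)
    qed simp
  qed
  also have "\<dots> < \<infinity>"
    by (subst nn_integral_cmult_indicator) (auto simp: ennreal_mult[symmetric])
  finally have wfin: "(\<integral>\<^sup>+x. ?w x * indicator {?g 0..?g pi} x \<partial>lborel) < \<infinity>" .
  have wpos: "0 \<le> ?w x * indicator {?g 0..?g pi} x" for x
  proof (cases "x \<in> {?g 0..?g pi}")
    case True
    then have "\<bar>x\<bar> \<le> 2" by auto
    then have "x\<^sup>2 \<le> 2\<^sup>2" by (metis abs_ge_zero power2_abs power_mono)
    then show ?thesis by simp
  qed simp
  have wint: "integrable lborel (\<lambda>x. ?w x * indicator {?g 0..?g pi} x)"
  proof (rule integrableI_bounded)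
    show "(\<integral>\<^sup>+x. norm (?w x * indicator {?g 0..?g pi} x) \<partial>lborel) < \<infinity>"
      using wfin by (simp only: real_norm_def abs_of_nonneg[OF wpos])
  qed measurable
  have "compact (h ` {-2..2})" by (intro compact_continuous_image continuous_on_subset[OF h]) auto
  then obtain M where M: "\<And>x. x \<in> {-2..2} \<Longrightarrow> \<bar>h x\<bar> \<le> M"
    by (metis compact_imp_bounded bounded_real imageI)
  let ?f = "\<lambda>x. h x * ?w x"
  have fint: "set_integrable lborel {?g 0..?g pi} ?f"
    unfolding set_integrable_def
  proof (rule Bochner_Integration.integrable_bound[OF integrable_mult_right[OF wint, of M]])
    show "AE x in lborel. norm (indicator {?g 0..?g pi} x *\<^sub>R ?f x) \<le> norm (M * (?w x * indicator {?g 0..?g pi} x))"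
    proof (rule AE_I2)
      fix x
      show "norm (indicator {?g 0..?g pi} x *\<^sub>R ?f x) \<le> norm (M * (?w x * indicator {?g 0..?g pi} x))"
      proof (cases "x \<in> {-2..2}")
        case True
        then have "\<bar>h x\<bar> * \<bar>?w x\<bar> \<le> \<bar>M\<bar> * \<bar>?w x\<bar>"
          using M[OF True] by (intro mult_right_mono) auto
        then show ?thesis using True by (simp add: abs_mult)
      qed simp
    qed
  qed measurable
  have "(LBINT x:{-2..2}. h x / (pi * sqrt (4 - x\<^sup>2))) = (LBINT x. ?f x * indicator {?g 0..?g pi} x)"
    unfolding set_lebesgue_integral_def by (intro Bochner_Integration.integral_cong) auto
  also have "\<dots> = (LBINT t. ?f (?g t) * ?g' t * indicator {0..pi} t)"
    by (rule integral_substitution(2)[OF fint deriv cont pos]) auto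
  also have "\<dots> = (LBINT t. h (?g t) / pi * indicator {0<..<pi} t)"
  proof (rule Bochner_Integration.integral_cong[OF refl])
    fix t
    show "?f (?g t) * ?g' t * indicator {0..pi} t = h (?g t) / pi * indicator {0<..<pi} t"
    proof (cases "t \<in> {0..pi}")
      case True
      then show ?thesis using wg[OF True] by (simp only: mult.assoc) simp
    qed (auto simp: indicator_def)
  qed
  also have "\<dots> = (LBINT t. h (?g (pi + (- 1) * t)) / pi * indicator {0<..<pi} (pi + (- 1) * t))"
    by (subst lborel_integral_real_affine[of "- 1" _ pi]) simp_all
  also have "\<dots> = (LBINT t:{0<..<pi}. h (2 * cos t) / pi)"
    unfolding set_lebesgue_integral_def
    by (intro Bochner_Integration.integral_cong) (auto simp: indicator_def)
  also have "\<dots> = integral {0<..<pi} (\<lambda>t. h (2 * cos t) / pi)"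
  proof (rule set_borel_integral_eq_integral)
    have "set_integrable lborel {0..pi} (\<lambda>t. h (2 * cos t) / pi)"
      by (intro borel_integrable_atLeastAtMost' continuous_intros continuous_on_compose2[OF h]) auto
    then show "set_integrable lborel {0<..<pi} (\<lambda>t. h (2 * cos t) / pi)"
      by (rule set_integrable_subset) auto
  qed
  also have "\<dots> = integral {0..pi} (\<lambda>t. h (2 * cos t)) / pi"
    by (simp add: integral_open_interval_real)
  finally show ?thesis .
qed

theorem mainTheorem13:
  fixes V :: "real \<Rightarrow> real" and \<mu> :: "real measure" and b c :: real
  assumes "admissible_potential V"
    and "C_k 3 V"
    and "equilibrium_measure V \<mu>"
    and "c > 0"
    and "measure_support \<mu> = {-2 * c + b .. 2 * c + b}"
  shows "I_min V = ereal (
     - ln c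
     + (LBINT x:{-2..2}. V (c * x + b) / (pi * sqrt (4 - x\<^sup>2)))
     - (LBINT s:{0..c}. s *
          ((LBINT x:{-2..2}. x * deriv V (s * x + b) / (2 * pi * sqrt (4 - x\<^sup>2)))\<^sup>2
           + (LBINT x:{-2..2}. deriv V (s * x + b) / (pi * sqrt (4 - x\<^sup>2)))\<^sup>2)))"
proof -
  have diff: "(deriv ^^ j) V field_differentiable at x" if "j < 3" for j x
    using assms(2) that by (auto simp: C_k_def)
  have d: "(V has_real_derivative deriv V x) (at x)" for x
    using diff[of 0 x] by (simp add: field_differentiable_derivI)
  have d': "(deriv V has_real_derivative deriv (deriv V) x) (at x)" for x
    using diff[of 1 x] by (simp add: field_differentiable_derivI)
  have "isCont (deriv (deriv V)) x" for x
    using diff[of 2 x] by (simp add: numeral_2_eq_2 field_differentiable_imp_continuous_at)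
  then have c2: "continuous_on UNIV (deriv (deriv V))"
    by (simp add: continuous_at_imp_continuous_on)
  have c1: "continuous_on UNIV (deriv V)"
    using d' by (meson DERIV_isCont continuous_at_imp_continuous_on)
  have c0: "continuous_on UNIV V"
    using d by (meson DERIV_isCont continuous_at_imp_continuous_on)
  let ?A = "\<lambda>n s. cosine_coeff (\<lambda>t. V (s * (2 * cos t) + b)) n"
  let ?G = "\<lambda>n s. cosine_coeff (\<lambda>t. deriv V (s * (2 * cos t) + b)) n"
  have A0: "(LBINT x:{-2..2}. V (c * x + b) / (pi * sqrt (4 - x\<^sup>2))) = ?A 0 c"
    by (subst integral_chebyshev_weight)
       (auto simp: cosine_coeff_def intro!: continuous_intros continuous_on_compose2[OF c0])
  have G0: "(LBINT x:{-2..2}. deriv V (s * x + b) / (pi * sqrt (4 - x\<^sup>2))) = ?G 0 s" for s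
    by (subst integral_chebyshev_weight)
       (auto simp: cosine_coeff_def intro!: continuous_intros continuous_on_compose2[OF c1])
  \<comment> \<open>With x = 2 cos t the factor x / 2 is cos t, which accounts for 2 pi in place of
    pi.\<close>
  have G1: "(LBINT x:{-2..2}. x * deriv V (s * x + b) / (2 * pi * sqrt (4 - x\<^sup>2))) = ?G 1 s" for s
  proof -
    have "(LBINT x:{-2..2}. x * deriv V (s * x + b) / (2 * pi * sqrt (4 - x\<^sup>2))) =
        (LBINT x:{-2..2}. (x / 2 * deriv V (s * x + b)) / (pi * sqrt (4 - x\<^sup>2)))"
      by (simp add: mult.assoc)
    also have "\<dots> = integral {0..pi} (\<lambda>t. 2 * cos t / 2 * deriv V (s * (2 * cos t) + b)) / pi"
      by (rule integral_chebyshev_weight)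
         (auto intro!: continuous_intros continuous_on_compose2[OF c1])
    finally show ?thesis by (simp add: cosine_coeff_def mult.commute)
  qed
  have cG: "continuous_on {0..c} (?G n)" for n
    by (rule cosine_coeff_circle_continuous[OF c1])
  have J: "(LBINT s:{0..c}. s * ((?G 1 s)\<^sup>2 + (?G 0 s)\<^sup>2)) =
      integral {0..c} (\<lambda>s. s * ((?G 0 s)\<^sup>2 + (?G 1 s)\<^sup>2))"
    using cG[of 0] cG[of 1]
    by (subst set_borel_integral_eq_integral(2))
       (intro borel_integrable_atLeastAtMost' continuous_intros, assumption+, simp add: add.commute)
  \<comment> \<open>One series is summed in two ways: the equilibrium condition gives A_0 minus the
    integral of V against \<open>\<mu>\<close>, the energy identity gives twice the integral over
    s.\<close>
  have "(\<lambda>n. real (Suc n) * (?A (Suc n) c)\<^sup>2) sums (?A 0 c - integral\<^sup>L \<mu> V)"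
    by (rule equilibrium_integral_sums[OF c0 assms(3,4,5)])
       (use cosine_coeff_circle_summable[OF d d' c2] assms(4) in simp)
  moreover have "(\<lambda>n. real (Suc n) * (?A (Suc n) c)\<^sup>2) sums
      (2 * integral {0..c} (\<lambda>s. s * ((?G 0 s)\<^sup>2 + (?G 1 s)\<^sup>2)))"
    using assms(4) by (intro cosine_coeff_energy_sums[OF d d' c2]) simp
  ultimately have "?A 0 c - integral\<^sup>L \<mu> V = 2 * integral {0..c} (\<lambda>s. s * ((?G 0 s)\<^sup>2 + (?G 1 s)\<^sup>2))"
    by (rule sums_unique2)
  \<comment> \<open>Writing m for the integral of V against \<open>\<mu>\<close>, the energy (A_0 +
    m) / 2 - ln c equals A_0 - (A_0 - m) / 2 - ln c, and A_0 - m is twice the integral over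
    s.\<close>
  then show ?thesis
    unfolding equilibrium_cosine_moments(2)[OF c0 assms(3,4,5)] A0 G0 G1 J
    by (simp add: field_simps)
qed

end
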